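(* Let $\epsilon\in\{-1,1\}$ be fixed. The equivalence group $G^\sim_{\mathcal K^\epsilon}$ of the class $\mathcal K^\epsilon$ of reduced Kolmogorov equations $u_t=\epsilon u_{xx}+B(t,x)u_x$ consists of the point transformations of the form \[ \tilde t=T(t),\quad\tilde x=X^1(t)x+X^0(t),\quad\tilde u=c_1u+c_2,\quad\tilde B=\frac1{X^1}B-\frac{X^1_tx+X^0_t}{(X^1)^2}, \] where $T$, $X^0$ and $X^1$ are arbitrary smooth functions of $t$ with $X^1\neq0$ and $T_t=(X^1)^2$, and $c_1$ and $c_2$ are arbitrary constants with $c_1\ne0$.
   Context: Everything is real, smooth and local; $f\neq0$ for a function means that it vanishes nowhere on its domain. The arbitrary element of the class is the smooth function $B$ of $(t,x)$, regarded as a coordinate when working with equivalence transformations. The (usual) equivalence (pseudo)group of the class consists of the point transformations (local diffeomorphisms) in the space with coordinates $(t,x,u_{(2)},B)$, where $u_{(2)}$ denotes $u$ and its derivatives up to order two, that are projectable to the spaces of $(t,x,u)$ and of $(t,x,u_{(2)})$, are consistent with the contact structure of the second-order jet space (so their components for derivatives are obtained by standard prolongation and are not listed), and map every equation of the class to an equation of the class (with the transformed arbitrary element) for any value of the arbitrary element. *)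

theory Defs
  imports "HOL-Analysis.Analysis"
begin

text \<open>\<open>Ck_on k S f\<close> for open \<open>S\<close>: all iterated directional derivatives of \<open>f\<close> up to order \<open>k\<close> exist
  (as values of Frechet derivatives) and are continuous on \<open>S\<close>.\<close>

primrec Ck_on :: "nat \<Rightarrow> 'a::real_normed_vector set \<Rightarrow> ('a \<Rightarrow> 'b::real_normed_vector) \<Rightarrow> bool" where
  "Ck_on 0 S f \<longleftrightarrow> continuous_on S f"
| "Ck_on (Suc k) S f \<longleftrightarrow>
     (\<forall>x\<in>S. f differentiable (at x)) \<and> (\<forall>v. Ck_on k S (\<lambda>x. frechet_derivative f (at x) v))"

definition smooth_on :: "'a::real_normed_vector set \<Rightarrow> ('a \<Rightarrow> 'b::real_normed_vector) \<Rightarrow> bool" where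
  "smooth_on S f \<longleftrightarrow> (\<forall>k. Ck_on k S f)"

definition diffeo_on :: "'a::real_normed_vector set \<Rightarrow> ('a \<Rightarrow> 'b::real_normed_vector) \<Rightarrow> bool" where
  "diffeo_on S f \<longleftrightarrow> smooth_on S f \<and> open (f ` S) \<and>
     (\<exists>g. smooth_on (f ` S) g \<and> (\<forall>x\<in>S. g (f x) = x))"

text \<open>Coordinates: \<open>(t, x, u)\<close>; then \<open>(u\<^sub>t, u\<^sub>x)\<close>; then \<open>(u\<^sub>t\<^sub>t, u\<^sub>t\<^sub>x, u\<^sub>x\<^sub>x)\<close>; and finally the
  arbitrary element \<open>B\<close>.\<close>

type_synonym base = "real \<times> real \<times> real"
type_synonym jet1 = "base \<times> (real \<times> real)"
type_synonym jet2 = "base \<times> (real \<times> real) \<times> (real \<times> real \<times> real)"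
type_synonym ext = "jet2 \<times> real"

definition tx_of :: "jet2 \<Rightarrow> real \<times> real" where
  "tx_of = (\<lambda>((t, x, u), _). (t, x))"

definition time_range :: "ext set \<Rightarrow> real set" where
  "time_range D = (\<lambda>(((t, x, u), _), _). t) ` D"

text \<open>The equation \<open>u\<^sub>t = \<epsilon> u\<^sub>x\<^sub>x + B(t,x) u\<^sub>x\<close> as a subset of the second-order jet space.\<close>

definition kolmogorov :: "real \<Rightarrow> (real \<times> real \<Rightarrow> real) \<Rightarrow> jet2 set" where
  "kolmogorov \<epsilon> B = {((t, x, u), (ut, ux), (utt, utx, uxx)) | t x u ut ux utt utx uxx.
     ut = \<epsilon> * uxx + B (t, x) * ux}"

text \<open>The Cartan plane at a jet: the common kernel of the contact forms
  \<open>du - u\<^sub>t dt - u\<^sub>x dx\<close>, \<open>du\<^sub>t - u\<^sub>t\<^sub>t dt - u\<^sub>t\<^sub>x dx\<close>, \<open>du\<^sub>x - u\<^sub>t\<^sub>x dt - u\<^sub>x\<^sub>x dx\<close>.\<close>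

definition cartan :: "jet2 \<Rightarrow> jet2 set" where
  "cartan = (\<lambda>((t, x, u), (ut, ux), (utt, utx, uxx)).
     {((dt, dx, du), (dut, dux), w) | dt dx du dut dux w.
        du = ut * dt + ux * dx \<and>
        dut = utt * dt + utx * dx \<and>
        dux = utx * dt + uxx * dx})"

definition contact_on :: "ext set \<Rightarrow> (ext \<Rightarrow> ext) \<Rightarrow> bool" where
  "contact_on D \<Phi> \<longleftrightarrow> (\<forall>p\<in>D. \<forall>v. fst v \<in> cartan (fst p) \<longrightarrow>
     fst (frechet_derivative \<Phi> (at p) v) \<in> cartan (fst (\<Phi> p)))"

definition projectable_on :: "ext set \<Rightarrow> (ext \<Rightarrow> ext) \<Rightarrow> bool" where
  "projectable_on D \<Phi> \<longleftrightarrow>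
     (\<exists>\<phi> :: base \<Rightarrow> base. \<forall>(j, b)\<in>D. fst (fst (\<Phi> (j, b))) = \<phi> (fst j)) \<and>
     (\<exists>\<psi> :: jet2 \<Rightarrow> jet2. \<forall>(j, b)\<in>D. fst (\<Phi> (j, b)) = \<psi> j)"

text \<open>For every arbitrary element \<open>B\<close> (a smooth function on some open set \<open>W\<close> of the \<open>(t,x)\<close>-plane),
  the part of its graph over the jet space that lies in \<open>D\<close> is mapped into the graph of a
  smooth function \<open>B'\<close> of the new \<open>(t,x)\<close> alone, and along this graph the equation with \<open>B\<close> goes
  over to the equation with \<open>B'\<close>.\<close>

definition preserves_class_on :: "real \<Rightarrow> ext set \<Rightarrow> (ext \<Rightarrow> ext) \<Rightarrow> bool" where
  "preserves_class_on \<epsilon> D \<Phi> \<longleftrightarrow>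
     (\<forall>W B. open W \<longrightarrow> smooth_on W B \<longrightarrow>
       (\<exists>W' B'. open W' \<and> smooth_on W' B' \<and>
         (\<forall>j. tx_of j \<in> W \<longrightarrow> (j, B (tx_of j)) \<in> D \<longrightarrow>
           (case \<Phi> (j, B (tx_of j)) of (j', b') \<Rightarrow>
             tx_of j' \<in> W' \<and> b' = B' (tx_of j') \<and>
             (j \<in> kolmogorov \<epsilon> B \<longleftrightarrow> j' \<in> kolmogorov \<epsilon> B')))))"

text \<open>The elements of the equivalence pseudogroup that are defined on \<open>D\<close> (values outside \<open>D\<close> are
  irrelevant).\<close>

definition equivalence_group :: "real \<Rightarrow> ext set \<Rightarrow> (ext \<Rightarrow> ext) set" where
  "equivalence_group \<epsilon> D =
     {\<Phi>. diffeo_on D \<Phi> \<and> projectable_on D \<Phi> \<and> contact_on D \<Phi> \<and> preserves_class_on \<epsilon> D \<Phi>}"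

text \<open>Domains on which local statements are made. Convexity excludes domains on which a function
  with \<open>f\<^sub>x = f\<^sub>u = 0\<close> is not a function of \<open>t\<close>. The last condition says that over each occurring
  \<open>(t, x, u, B)\<close> the domain reaches the equation with that value of the arbitrary element;
  a domain disjoint from all equations would make the preservation of the class vacuous.
  By \<open>local_domain_nhd\<close> below, every neighbourhood of a point lying on an equation of
  the class contains such a domain, so all germs at such points are covered.\<close>

definition local_domain :: "real \<Rightarrow> ext set \<Rightarrow> bool" where
  "local_domain \<epsilon> D \<longleftrightarrow> open D \<and> convex D \<and>
     (\<forall>(j, b)\<in>D. \<exists>j'. fst j' = fst j \<and> (j', b) \<in> D \<and> j' \<in> kolmogorov \<epsilon> (\<lambda>_. b))"

text \<open>Standard prolongation of a point transformation \<open>\<phi>\<close> of the \<open>(t,x,u)\<close>-space: the total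
  derivatives of a component are its derivatives along the vectors \<open>Dt\<close> and \<open>Dx\<close>.
  If \<open>(a, b)\<close>, \<open>(a', b')\<close> are the total \<open>t\<close>- and \<open>x\<close>-derivatives of the new \<open>(t,x)\<close> and \<open>c, c'\<close>
  those of a function \<open>F\<close>, then \<open>total_quot (a, b) (a', b') c c'\<close> solves
  \<open>c = a F\<^sub>1 + b F\<^sub>2\<close>, \<open>c' = a' F\<^sub>1 + b' F\<^sub>2\<close> for the derivatives \<open>(F\<^sub>1, F\<^sub>2)\<close> of \<open>F\<close> with respect to
  the new \<open>(t,x)\<close>.\<close>

definition total_quot :: "real \<times> real \<Rightarrow> real \<times> real \<Rightarrow> real \<Rightarrow> real \<Rightarrow> real \<times> real" where
  "total_quot = (\<lambda>(a, b) (a', b') c c'.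
     ((c * b' - c' * b) / (a * b' - a' * b), (a * c' - a' * c) / (a * b' - a' * b)))"

definition prolong1 :: "(base \<Rightarrow> base) \<Rightarrow> jet1 \<Rightarrow> jet1" where
  "prolong1 \<phi> = (\<lambda>(z, (ut, ux)).
     let (a, b, c) = frechet_derivative \<phi> (at z) (1, 0, ut);
         (a', b', c') = frechet_derivative \<phi> (at z) (0, 1, ux)
     in (\<phi> z, total_quot (a, b) (a', b') c c'))"

definition prolong2 :: "(base \<Rightarrow> base) \<Rightarrow> jet2 \<Rightarrow> jet2" where
  "prolong2 \<phi> = (\<lambda>(z, (ut, ux), (utt, utx, uxx)).
     let Dt = ((1, 0, ut), (utt, utx));
         Dx = ((0, 1, ux), (utx, uxx));
         ((a, b, _), (p, q)) = frechet_derivative (prolong1 \<phi>) (at (z, (ut, ux))) Dt;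
         ((a', b', _), (p', q')) = frechet_derivative (prolong1 \<phi>) (at (z, (ut, ux))) Dx;
         (vtt, vtx) = total_quot (a, b) (a', b') p p';
         (_, vxx) = total_quot (a, b) (a', b') q q'
     in (fst (prolong1 \<phi> (z, (ut, ux))), snd (prolong1 \<phi> (z, (ut, ux))), (vtt, vtx, vxx)))"

lemma local_domain_nhd:
  fixes U :: "ext set"
  assumes "open U" "(j, b) \<in> U" "j \<in> kolmogorov \<epsilon> (\<lambda>_. b)"
  obtains D where "local_domain \<epsilon> D" "(j, b) \<in> D" "D \<subseteq> U"
proof -
  obtain t x u ut ux utt utx uxx where
    j: "j = ((t, x, u), (ut, ux), (utt, utx, uxx))" and e: "ut = \<epsilon> * uxx + b * ux"
    using assms(3) by (auto simp: kolmogorov_def)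
  obtain A1 A2 where A: "open A1" "open A2" "j \<in> A1" "b \<in> A2" "A1 \<times> A2 \<subseteq> U"
    using open_prod_elim[OF assms(1,2)] by (metis mem_Sigma_iff)
  obtain Z A3 where Z: "open Z" "open A3" "(t, x, u) \<in> Z" "((ut, ux), (utt, utx, uxx)) \<in> A3" "Z \<times> A3 \<subseteq> A1"
    using open_prod_elim[OF A(1,3)] unfolding j by (metis mem_Sigma_iff)
  obtain A4 A5 where A4: "open A4" "open A5" "(ut, ux) \<in> A4" "(utt, utx, uxx) \<in> A5" "A4 \<times> A5 \<subseteq> A3"
    using open_prod_elim[OF Z(2,4)] by (metis mem_Sigma_iff)
  obtain P Q where P: "open P" "open Q" "ut \<in> P" "ux \<in> Q" "P \<times> Q \<subseteq> A4"
    using open_prod_elim[OF A4(1,3)] by (metis mem_Sigma_iff)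
  obtain rP rZ rQ where rP: "rP > 0" "ball ut rP \<subseteq> P" and rZ: "rZ > 0" "ball (t, x, u) rZ \<subseteq> Z"
    and rQ: "rQ > 0" "ball ux rQ \<subseteq> Q"
    using P Z by (meson open_contains_ball)
  obtain r5 where r5: "r5 > 0" "ball (utt, utx, uxx) r5 \<subseteq> A5"
    using A4 by (meson open_contains_ball)
  let ?f = "\<lambda>b'::real. \<epsilon> * uxx + b' * ux"
  have "open (?f -` ball ut rP)" by (rule open_vimage) (auto intro!: continuous_intros)
  then have "open (A2 \<inter> ?f -` ball ut rP)" using A by auto
  moreover have "b \<in> A2 \<inter> ?f -` ball ut rP" using A rP e by auto
  ultimately obtain r2 where r2: "r2 > 0" "ball b r2 \<subseteq> A2 \<inter> ?f -` ball ut rP"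
    by (meson open_contains_ball)
  let ?D = "(ball (t, x, u) rZ \<times> (ball ut rP \<times> ball ux rQ) \<times> ball (utt, utx, uxx) r5) \<times> ball b r2"
  have "local_domain \<epsilon> ?D"
    unfolding local_domain_def
  proof (intro conjI)
    show "open ?D" by (intro open_Times open_ball)
    show "convex ?D" by (intro convex_Times convex_ball)
    have "\<exists>j'. fst j' = fst i \<and> (j', c) \<in> ?D \<and> j' \<in> kolmogorov \<epsilon> (\<lambda>_. c)" if "(i, c) \<in> ?D" for i c
      using that rQ r5 r2
      by (intro exI[of _ "(fst i, (?f c, ux), (utt, utx, uxx))"])
        (auto simp: kolmogorov_def mem_Times_iff prod_eq_iff)
    then show "\<forall>(i, c)\<in>?D. \<exists>j'. fst j' = fst i \<and> (j', c) \<in> ?D \<and> j' \<in> kolmogorov \<epsilon> (\<lambda>_. c)"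
      by blast
  qed
  moreover have "(j, b) \<in> ?D" using j rP rZ rQ r5 r2 by simp
  moreover have "?D \<subseteq> U"
  proof -
    have "ball ut rP \<times> ball ux rQ \<subseteq> A4" using P(5) rP(2) rQ(2) by (meson Sigma_mono order_trans)
    then have "(ball ut rP \<times> ball ux rQ) \<times> ball (utt, utx, uxx) r5 \<subseteq> A3"
      using A4(5) r5(2) by (meson Sigma_mono order_trans)
    then have "ball (t, x, u) rZ \<times> (ball ut rP \<times> ball ux rQ) \<times> ball (utt, utx, uxx) r5 \<subseteq> A1"
      using Z(5) rZ(2) by (meson Sigma_mono order_trans)
    moreover have "ball b r2 \<subseteq> A2" using r2(2) by simp
    ultimately show ?thesis using A(5) by (meson Sigma_mono order_trans)
  qed
  ultimately show thesis using that by blast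
qed

end

theory Submission
  imports Defs
begin

text \<open>
  Constant arbitrary elements already determine the group. Preservation of the contact structure
  expresses the transformed derivatives through the transformation \<open>(\<tau>, \<xi>, \<mu>)\<close> of \<open>(t, x, u)\<close>.
  Moving a jet along its equation in the \<open>u\<^sub>t\<^sub>t\<close>-direction forces \<open>\<tau> = T(t)\<close>, and moving it in the
  \<open>(u\<^sub>x\<^sub>x, u\<^sub>t)\<close>-direction forces \<open>\<xi>\<^sub>u = 0\<close> and \<open>\<xi>\<^sub>x\<^sup>2 = T\<^sub>t\<close>. What is left of the equation is a quadratic
  polynomial in \<open>u\<^sub>x\<close> whose coefficients give \<open>\<mu>\<^sub>u\<^sub>u = 0\<close> and the formula for the new arbitrary
  element; since one of the resulting relations is affine in \<open>B\<close> with leading coefficient \<open>\<mu>\<^sub>u \<mu>\<^sub>x\<close>,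
  varying \<open>B\<close> yields \<open>\<mu>\<^sub>x = 0\<close>, and then \<open>\<mu> = c\<^sub>1 u + c\<^sub>2\<close>.

  Conversely, the transformed equation is the original one multiplied by \<open>c\<^sub>1 / (X\<^sup>1)\<^sup>2\<close>, and the
  inverse of the transformation is computed by solving for the coordinates one after the other.
\<close>

subsection \<open>Calculus of \<open>C\<^sup>k\<close> functions\<close>

text \<open>The map of the \<open>(t, x, u)\<close>-space supplied by \<open>projectable_on\<close>
  is not known to be smooth, so the argument never descends to that space. The components of
  \<open>\<Phi>\<close> stay functions on \<open>D\<close>, and dependence on fewer coordinates
  means constancy on the fibres of a linear projection. Beyond what projectability gives, such
  dependence is integrated from vanishing derivatives along segments, which stay in the convex
  \<open>D\<close>. The equation says something only at jets lying on it, and jets can be moved only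
  slightly inside \<open>D\<close>. A jet on the equation exists over every
  \<open>(t, x, u, B)\<close> that occurs, and the derivatives of \<open>\<tau>\<close>,
  \<open>\<xi>\<close>, \<open>\<mu>\<close> do not see the jet coordinates, so relations among them
  found at such a jet hold throughout \<open>D\<close>. The new arbitrary element is unknown at
  first. For constant B it is a function of the new \<open>(t, x)\<close>, hence it keeps its value
  while the jet moves over fixed \<open>(t, x, u, B)\<close>; this makes the splitting in powers of
  \<open>u\<^sub>x\<close> legitimate.\<close>

lemma Ck_on_cong:
  assumes "open S" "\<And>x. x \<in> S \<Longrightarrow> f x = g x"
  shows "Ck_on k S f \<longleftrightarrow> Ck_on k S g"
  using assms(2)
proof (induction k arbitrary: f g)
  case 0
  then show ?case by (simp cong: continuous_on_cong)
next
  case (Suc k)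
  have *: "(f has_derivative f') (at x) \<longleftrightarrow> (g has_derivative f') (at x)" if "x \<in> S" for x f'
    by (rule iffI; erule has_derivative_transform_within_open[OF _ assms(1) that])
       (simp_all add: Suc.prems)
  have "f differentiable (at x) \<longleftrightarrow> g differentiable (at x)"
    "frechet_derivative f (at x) = frechet_derivative g (at x)" if "x \<in> S" for x
    using *[OF that] by (simp_all add: differentiable_def frechet_derivative_def)
  then show ?case
    using Suc.IH[of "\<lambda>x. frechet_derivative f (at x) v" "\<lambda>x. frechet_derivative g (at x) v" for v] by auto
qed

lemma Ck_on_SucI:
  assumes "open S" "\<And>x. x \<in> S \<Longrightarrow> (f has_derivative f' x) (at x)" "\<And>v. Ck_on k S (\<lambda>x. f' x v)"
  shows "Ck_on (Suc k) S f"
proof -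
  have "frechet_derivative f (at x) = f' x" if "x \<in> S" for x
    using frechet_derivative_at[OF assms(2)[OF that]] by simp
  then have "Ck_on k S (\<lambda>x. frechet_derivative f (at x) v) \<longleftrightarrow> Ck_on k S (\<lambda>x. f' x v)" for v
    by (intro Ck_on_cong) (auto simp: assms(1))
  then show ?thesis using assms by (auto intro: differentiableI)
qed

lemma Ck_on_SucD:
  assumes "Ck_on (Suc k) S f"
  shows "Ck_on k S f"
  using assms
proof (induction k arbitrary: f)
  case 0
  then show ?case
    by (auto intro!: continuous_at_imp_continuous_on differentiable_imp_continuous_within)
next
  case (Suc k)
  then show ?case by auto
qed

lemma Ck_on_has_derivative:
  assumes "Ck_on (Suc k) S f" "x \<in> S"
  shows "(f has_derivative frechet_derivative f (at x)) (at x)"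
  using assms frechet_derivative_works by (metis Ck_on.simps(2))

lemma Ck_on_const: "open S \<Longrightarrow> Ck_on k S (\<lambda>_. c)"
proof (induction k arbitrary: c)
  case (Suc k)
  show ?case by (rule Ck_on_SucI[where f' = "\<lambda>_ _. 0"]) (auto simp: Suc)
qed auto

lemma Ck_on_linear:
  assumes "bounded_linear f" "open S"
  shows "Ck_on k S f"
proof (cases k)
  case 0
  then show ?thesis using assms by (simp add: linear_continuous_on)
next
  case (Suc n)
  show ?thesis unfolding Suc
    by (rule Ck_on_SucI[where f' = "\<lambda>_. f"])
       (auto simp: assms Ck_on_const intro: bounded_linear_imp_has_derivative)
qed

lemma Ck_on_add:
  assumes "open S" "Ck_on k S f" "Ck_on k S g"
  shows "Ck_on k S (\<lambda>x. f x + g x)"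
  using assms(2,3)
proof (induction k arbitrary: f g)
  case 0
  then show ?case by (auto intro: continuous_on_add)
next
  case (Suc k)
  show ?case
    by (rule Ck_on_SucI[OF assms(1) has_derivative_add[OF Ck_on_has_derivative[OF Suc.prems(1)] Ck_on_has_derivative[OF Suc.prems(2)]]])
       (use Suc in auto)
qed

lemma Ck_on_sum:
  assumes "open S" "\<And>i. i \<in> I \<Longrightarrow> Ck_on k S (f i)"
  shows "Ck_on k S (\<lambda>x. \<Sum>i\<in>I. f i x)"
  using assms(2) by (induction I rule: infinite_finite_induct) (auto simp: Ck_on_const Ck_on_add assms(1))

lemma Ck_on_bounded_bilinear:
  assumes "bounded_bilinear h" "open S" "Ck_on k S f" "Ck_on k S g"
  shows "Ck_on k S (\<lambda>x. h (f x) (g x))"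
  using assms(3,4)
proof (induction k arbitrary: f g)
  case 0
  then show ?case by (auto intro: bounded_bilinear.continuous_on[OF assms(1)])
next
  case (Suc k)
  note c = Suc.prems Suc.prems[THEN Ck_on_SucD]
  show ?case
    by (rule Ck_on_SucI[OF assms(2) bounded_bilinear.FDERIV[OF assms(1) Ck_on_has_derivative[OF c(1)] Ck_on_has_derivative[OF c(2)]]])
       (use c in \<open>auto intro!: Ck_on_add assms Suc.IH\<close>)
qed

lemma Ck_on_linear_compose:
  assumes "bounded_linear h" "open S" "Ck_on k S f"
  shows "Ck_on k S (\<lambda>x. h (f x))"
  using assms(3)
proof (induction k arbitrary: f)
  case 0
  then show ?case by (auto intro: bounded_linear.continuous_on[OF assms(1)])
next
  case (Suc k)
  show ?case
    by (rule Ck_on_SucI[OF assms(2) bounded_linear.has_derivative[OF assms(1) Ck_on_has_derivative[OF Suc.prems]]])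
       (use Suc in auto)
qed

lemma Ck_on_Pair:
  assumes "open S" "Ck_on k S f" "Ck_on k S g"
  shows "Ck_on k S (\<lambda>x. (f x, g x))"
proof -
  have "Ck_on k S (\<lambda>x. (f x, 0) + (0, g x))"
    by (intro Ck_on_add assms Ck_on_linear_compose[where h = "\<lambda>y. (y, 0)"]
        Ck_on_linear_compose[where h = "\<lambda>y. (0, y)"] bounded_linear_Pair
        bounded_linear_ident bounded_linear_zero)
  then show ?thesis by simp
qed

text \<open>\<open>Ck_on\<close> controls the derivative of \<open>g\<close> in fixed directions
  only, whereas the chain rule uses the direction \<open>?f' x v\<close>, which varies with
  \<open>x\<close>. Expanding that direction in an orthonormal basis gives a finite sum of products
  to which the induction hypothesis applies; hence the Euclidean middle space.\<close>

lemma Ck_on_compose: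
  fixes g :: "'b::euclidean_space \<Rightarrow> 'c::real_normed_vector"
  assumes "open S" "open U" "Ck_on k S f" "Ck_on k U g" "f ` S \<subseteq> U"
  shows "Ck_on k S (\<lambda>x. g (f x))"
  using assms(3,4)
proof (induction k arbitrary: g)
  case 0
  then show ?case using assms(5) by (auto intro: continuous_on_compose2)
next
  case (Suc k)
  note c = Suc.prems Suc.prems(1)[THEN Ck_on_SucD]
  let ?f' = "\<lambda>x. frechet_derivative f (at x)" and ?g' = "\<lambda>y. frechet_derivative g (at y)"
  show ?case
  proof (rule Ck_on_SucI[OF assms(1)])
    fix x assume x: "x \<in> S"
    have f: "(f has_derivative ?f' x) (at x)" and g: "(g has_derivative ?g' (f x)) (at (f x))"
      using c x assms(5) by (auto intro!: Ck_on_has_derivative)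
    have *: "(\<Sum>i\<in>Basis. (w \<bullet> i) *\<^sub>R ?g' (f x) i) = ?g' (f x) w" for w
    proof -
      have "?g' (f x) w = ?g' (f x) (\<Sum>i\<in>Basis. (w \<bullet> i) *\<^sub>R i)"
        by (simp add: euclidean_representation)
      then show ?thesis
        by (simp add: linear_sum[OF has_derivative_linear[OF g]] linear_scale[OF has_derivative_linear[OF g]])
    qed
    show "((\<lambda>x. g (f x)) has_derivative
        (\<lambda>v. \<Sum>i\<in>Basis. (?f' x v \<bullet> i) *\<^sub>R ?g' (f x) i)) (at x)"
      unfolding * by (rule has_derivative_compose[OF f g])
  next
    fix v
    show "Ck_on k S (\<lambda>x. \<Sum>i\<in>Basis. (?f' x v \<bullet> i) *\<^sub>R ?g' (f x) i)"
    proof (intro Ck_on_sum assms Ck_on_bounded_bilinear[OF bounded_bilinear_scaleR])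
      fix i :: 'b
      show "Ck_on k S (\<lambda>x. ?f' x v \<bullet> i)"
        using c by (intro Ck_on_linear_compose[OF bounded_linear_inner_left] assms) auto
      show "Ck_on k S (\<lambda>x. ?g' (f x) i)"
        using c by (intro Suc.IH) auto
    qed
  qed
qed

lemma Ck_on_inverse: "Ck_on k (- {0}) (inverse :: real \<Rightarrow> real)"
proof (induction k)
  case 0
  then show ?case by (auto intro: continuous_intros)
next
  case (Suc k)
  show ?case
  proof (rule Ck_on_SucI)
    show "(inverse has_derivative (\<lambda>h. - (inverse x * h * inverse x))) (at x)"
      if "x \<in> - {0}" for x :: real using that has_derivative_inverse' by fastforce
    have "Ck_on k (- {0}) (\<lambda>x. - v * (inverse x * inverse x))" for v :: real
      by (intro Ck_on_bounded_bilinear[OF bounded_bilinear_mult] Suc Ck_on_const) auto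
    then show "Ck_on k (- {0}) (\<lambda>x. - (inverse x * v * inverse x))" for v :: real
      by (simp add: ac_simps)
  qed auto
qed

lemma Ck_on_local:
  assumes "\<And>x. x \<in> S \<Longrightarrow> \<exists>U. open U \<and> x \<in> U \<and> Ck_on k U f"
  shows "Ck_on k S f"
  using assms
proof (induction k arbitrary: f)
  case 0
  then show ?case
    by (metis Ck_on.simps(1) continuous_at_imp_continuous_on continuous_on_eq_continuous_at)
next
  case (Suc k)
  show ?case unfolding Ck_on.simps
  proof (intro conjI ballI allI Suc.IH)
    fix x assume "x \<in> S"
    then obtain U where "x \<in> U" "Ck_on (Suc k) U f" using Suc.prems by blast
    then show "f differentiable (at x)" by simp
  next
    fix v x assume "x \<in> S"
    then obtain U where "open U" "x \<in> U" "Ck_on (Suc k) U f" using Suc.prems by blast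
    then show "\<exists>U. open U \<and> x \<in> U \<and> Ck_on k U (\<lambda>x. frechet_derivative f (at x) v)"
      by auto
  qed
qed

subsection \<open>Smooth functions\<close>

lemma smooth_onD: "smooth_on S f \<Longrightarrow> Ck_on k S f"
  by (simp add: smooth_on_def)

lemma smooth_on_cong:
  assumes "open S" "\<And>x. x \<in> S \<Longrightarrow> f x = g x"
  shows "smooth_on S f \<longleftrightarrow> smooth_on S g"
  using Ck_on_cong[OF assms] by (simp add: smooth_on_def)

lemma smooth_on_has_derivative:
  "smooth_on S f \<Longrightarrow> x \<in> S \<Longrightarrow> (f has_derivative frechet_derivative f (at x)) (at x)"
  using Ck_on_has_derivative smooth_onD by blast

lemma smooth_on_frechet_derivative:
  "smooth_on S f \<Longrightarrow> smooth_on S (\<lambda>x. frechet_derivative f (at x) v)"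
  by (metis Ck_on.simps(2) smooth_on_def)

lemma smooth_on_imp_continuous_on: "smooth_on S f \<Longrightarrow> continuous_on S f"
  by (metis Ck_on.simps(1) smooth_onD)

lemma smooth_on_linear: "bounded_linear f \<Longrightarrow> open S \<Longrightarrow> smooth_on S f"
  by (simp add: smooth_on_def Ck_on_linear)

lemma smooth_on_linear_compose:
  "bounded_linear h \<Longrightarrow> open S \<Longrightarrow> smooth_on S f \<Longrightarrow> smooth_on S (\<lambda>x. h (f x))"
  by (simp add: smooth_on_def Ck_on_linear_compose)

lemma smooth_on_compose:
  fixes g :: "'b::euclidean_space \<Rightarrow> 'c::real_normed_vector"
  assumes "smooth_on U g" "open U" "open S" "smooth_on S f" "\<And>x. x \<in> S \<Longrightarrow> f x \<in> U"
  shows "smooth_on S (\<lambda>x. g (f x))"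
proof -
  have "f ` S \<subseteq> U" using assms(5) by blast
  then have "Ck_on k S (\<lambda>x. g (f x))" for k
    by (rule Ck_on_compose[OF assms(3,2) smooth_onD[OF assms(4)] smooth_onD[OF assms(1)]])
  then show ?thesis by (simp add: smooth_on_def)
qed

named_theorems smooth_intros

lemma smooth_on_const [smooth_intros]: "open S \<Longrightarrow> smooth_on S (\<lambda>_. c)"
  by (simp add: smooth_on_def Ck_on_const)

lemma smooth_on_ident [smooth_intros]: "open S \<Longrightarrow> smooth_on S (\<lambda>x. x)"
  by (simp add: smooth_on_linear)

lemma smooth_on_add [smooth_intros]:
  "open S \<Longrightarrow> smooth_on S f \<Longrightarrow> smooth_on S g \<Longrightarrow> smooth_on S (\<lambda>x. f x + g x)"
  by (simp add: smooth_on_def Ck_on_add)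

lemma smooth_on_minus [smooth_intros]:
  "open S \<Longrightarrow> smooth_on S f \<Longrightarrow> smooth_on S (\<lambda>x. - f x)"
  by (rule smooth_on_linear_compose[OF bounded_linear_minus[OF bounded_linear_ident]])

lemma smooth_on_diff [smooth_intros]:
  "open S \<Longrightarrow> smooth_on S f \<Longrightarrow> smooth_on S g \<Longrightarrow> smooth_on S (\<lambda>x. f x - g x)"
  using smooth_on_add[OF _ _ smooth_on_minus, of S f g] by simp

lemma smooth_on_mult [smooth_intros]:
  fixes f g :: "'a::real_normed_vector \<Rightarrow> real"
  shows "open S \<Longrightarrow> smooth_on S f \<Longrightarrow> smooth_on S g \<Longrightarrow> smooth_on S (\<lambda>x. f x * g x)"
  by (simp add: smooth_on_def Ck_on_bounded_bilinear[OF bounded_bilinear_mult])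

lemma smooth_on_power [smooth_intros]:
  fixes f :: "'a::real_normed_vector \<Rightarrow> real"
  shows "open S \<Longrightarrow> smooth_on S f \<Longrightarrow> smooth_on S (\<lambda>x. f x ^ n)"
  by (induction n) (auto intro: smooth_intros)

lemma smooth_on_divide [smooth_intros]:
  fixes f g :: "'a::real_normed_vector \<Rightarrow> real"
  assumes "open S" "smooth_on S f" "smooth_on S g" "\<And>x. x \<in> S \<Longrightarrow> g x \<noteq> 0"
  shows "smooth_on S (\<lambda>x. f x / g x)"
proof -
  have "smooth_on (- {0}) (inverse :: real \<Rightarrow> real)"
    by (simp add: smooth_on_def Ck_on_inverse)
  then have "smooth_on S (\<lambda>x. inverse (g x))"
    by (rule smooth_on_compose[OF _ _ assms(1,3)]) (use assms(4) in auto)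
  then show ?thesis
    unfolding divide_inverse by (rule smooth_on_mult[OF assms(1,2)])
qed

lemma smooth_on_Pair [smooth_intros]:
  "open S \<Longrightarrow> smooth_on S f \<Longrightarrow> smooth_on S g \<Longrightarrow> smooth_on S (\<lambda>x. (f x, g x))"
  by (simp add: smooth_on_def Ck_on_Pair)

lemma smooth_on_fst [smooth_intros]:
  "open S \<Longrightarrow> smooth_on S f \<Longrightarrow> smooth_on S (\<lambda>x. fst (f x))"
  by (rule smooth_on_linear_compose[OF bounded_linear_fst])

lemma smooth_on_snd [smooth_intros]:
  "open S \<Longrightarrow> smooth_on S f \<Longrightarrow> smooth_on S (\<lambda>x. snd (f x))"
  by (rule smooth_on_linear_compose[OF bounded_linear_snd])

lemma smooth_on_local:
  assumes "\<And>x. x \<in> S \<Longrightarrow> \<exists>U. open U \<and> x \<in> U \<and> smooth_on U f"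
  shows "smooth_on S f"
  unfolding smooth_on_def using assms by (intro allI Ck_on_local) (meson smooth_onD)

lemma deriv_eq_frechet_derivative:
  fixes f :: "real \<Rightarrow> real"
  assumes "f differentiable (at x)"
  shows "frechet_derivative f (at x) v = deriv f x * v"
proof -
  have "(f has_real_derivative deriv f x) (at x)"
    using assms DERIV_deriv_iff_real_differentiable by blast
  then show ?thesis
    using frechet_derivative_at unfolding has_field_derivative_def by metis
qed

lemma smooth_on_has_real_derivative:
  fixes f :: "real \<Rightarrow> real"
  assumes "smooth_on S f" "x \<in> S"
  shows "(f has_real_derivative deriv f x) (at x)"
  using smooth_on_has_derivative[OF assms] DERIV_deriv_iff_real_differentiable differentiableI by blast

lemma smooth_on_deriv:
  fixes f :: "real \<Rightarrow> real"
  assumes "open S" "smooth_on S f"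
  shows "smooth_on S (deriv f)"
proof -
  have "smooth_on S (\<lambda>x. frechet_derivative f (at x) 1)"
    using assms(2) by (rule smooth_on_frechet_derivative)
  moreover have "frechet_derivative f (at x) 1 = deriv f x" if "x \<in> S" for x
    using deriv_eq_frechet_derivative[of f x 1] smooth_on_has_derivative[OF assms(2) that]
    by (auto intro: differentiableI)
  ultimately show ?thesis by (rule iffD1[OF smooth_on_cong[OF assms(1)], rotated])
qed

text \<open>Bootstrapping: the derivative of \<open>g\<close> is \<open>1 / deriv f\<close> composed
  with \<open>g\<close>, so each order of regularity of \<open>g\<close> yields the next
  one.\<close>

lemma smooth_on_inverse_function:
  fixes f :: "real \<Rightarrow> real"
  assumes "open S" "smooth_on S f" "open (f ` S)"
    and g: "\<And>x. x \<in> S \<Longrightarrow> g (f x) = x" and nz: "\<And>x. x \<in> S \<Longrightarrow> deriv f x \<noteq> 0"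
  shows "smooth_on (f ` S) g"
proof -
  have d: "(g has_derivative (*) (1 / deriv f (g y))) (at y)" if y: "y \<in> f ` S" for y
  proof -
    from y obtain x where x: "x \<in> S" "y = f x" by auto
    have "(g has_derivative (*) (1 / deriv f x)) (at (f x))"
      by (rule has_derivative_inverse_strong[OF assms(1) x(1) smooth_on_imp_continuous_on[OF assms(2)] g
            smooth_on_has_real_derivative[OF assms(2) x(1), unfolded has_field_derivative_def]])
         (use x nz in \<open>auto simp: fun_eq_iff\<close>)
    then show ?thesis using x g by simp
  qed
  have "Ck_on k (f ` S) g" for k
  proof (induction k)
    case 0
    then show ?case using d has_derivative_continuous by (force intro!: continuous_at_imp_continuous_on)
  next
    case (Suc k)
    have "smooth_on S (\<lambda>x. 1 / deriv f x)"
      by (intro smooth_intros smooth_on_deriv assms nz) auto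
    then have "Ck_on k (f ` S) (\<lambda>y. 1 / deriv f (g y))"
      by (rule Ck_on_compose[OF assms(3,1) Suc smooth_onD]) (auto simp: g)
    then have "Ck_on k (f ` S) (\<lambda>y. 1 / deriv f (g y) * v)" for v
      by (rule Ck_on_bounded_bilinear[OF bounded_bilinear_mult assms(3) _ Ck_on_const[OF assms(3)]])
    then show ?case by (intro Ck_on_SucI[OF assms(3) d])
  qed
  then show ?thesis by (simp add: smooth_on_def)
qed

subsection \<open>Functions that factor through a linear map\<close>

abbreviation dd :: "('a::real_normed_vector \<Rightarrow> 'b::real_normed_vector) \<Rightarrow> 'a \<Rightarrow> 'a \<Rightarrow> 'b" where
  "dd F p v \<equiv> frechet_derivative F (at p) v"

text \<open>No function on the image of \<open>\<pi>\<close> is introduced, so that \<open>F\<close>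
  stays a smooth function on the open set \<open>D\<close> and can be differentiated there.\<close>

definition factors_on :: "'a set \<Rightarrow> ('a \<Rightarrow> 'c) \<Rightarrow> ('a \<Rightarrow> 'b) \<Rightarrow> bool" where
  "factors_on D \<pi> F \<longleftrightarrow> (\<forall>p\<in>D. \<forall>q\<in>D. \<pi> p = \<pi> q \<longrightarrow> F p = F q)"

lemma factors_onD: "factors_on D \<pi> F \<Longrightarrow> p \<in> D \<Longrightarrow> q \<in> D \<Longrightarrow> \<pi> p = \<pi> q \<Longrightarrow> F p = F q"
  unfolding factors_on_def by blast

lemma open_line:
  fixes D :: "'a::real_normed_vector set"
  assumes "open D" "p \<in> D"
  obtains r :: real where "r > 0" "\<And>s. \<bar>s\<bar> < r \<Longrightarrow> p + s *\<^sub>R v \<in> D"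
proof -
  have "open ((\<lambda>s. p + s *\<^sub>R v) -` D)"
    by (intro open_vimage assms continuous_intros)
  then obtain r where r: "r > 0" "ball 0 r \<subseteq> (\<lambda>s. p + s *\<^sub>R v) -` D"
    using assms(2) by (metis (mono_tags, lifting) open_contains_ball add.right_neutral scaleR_zero_left vimage_eq)
  show thesis by (rule that[OF r(1)]) (use r(2) in \<open>auto simp: subset_iff\<close>)
qed

lemma has_derivative_eq_on_open:
  assumes "open D" "p \<in> D" "\<And>q. q \<in> D \<Longrightarrow> F q = G q"
    "(F has_derivative F') (at p)" "(G has_derivative G') (at p)"
  shows "F' v = G' v"
  using has_derivative_unique[OF has_derivative_transform_within_open[OF assms(4,1,2,3)] assms(5)] by simp

lemma smooth_on_linear_frechet_derivative:
  assumes "smooth_on D F" "p \<in> D"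
  shows "linear (frechet_derivative F (at p))"
  using has_derivative_linear[OF smooth_on_has_derivative[OF assms]] .

text \<open>Translation by \<open>q - p\<close> maps every fibre of \<open>\<pi>\<close> to itself,
  so near \<open>p\<close> the function coincides with its translate, whose derivative at
  \<open>p\<close> is that of \<open>F\<close> at \<open>q\<close>.\<close>

lemma factors_on_dd:
  fixes F :: "'a::real_normed_vector \<Rightarrow> 'b::real_normed_vector"
  assumes D: "open D" and F: "smooth_on D F" and pi: "linear \<pi>" and f: "factors_on D \<pi> F"
  shows "factors_on D \<pi> (\<lambda>p. dd F p v)"
  unfolding factors_on_def
proof (intro ballI impI)
  fix p q assume pq: "p \<in> D" "q \<in> D" "\<pi> p = \<pi> q"
  let ?D = "D \<inter> (\<lambda>y. y + (q - p)) -` D"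
  have "((\<lambda>y. F (y + (q - p))) has_derivative dd F q) (at p)"
  proof (rule has_derivative_compose[where f' = "\<lambda>v. v"])
    show "((\<lambda>y. y + (q - p)) has_derivative (\<lambda>v. v)) (at p)"
      using has_derivative_add[OF has_derivative_ident has_derivative_const[of "q - p"]] by simp
    show "(F has_derivative dd F q) (at (p + (q - p)))"
      using smooth_on_has_derivative[OF F pq(2)] by simp
  qed
  moreover have "open ?D" "p \<in> ?D"
    using D pq by (auto intro!: open_Int open_vimage continuous_intros)
  moreover have "F y = F (y + (q - p))" if "y \<in> ?D" for y
    using that factors_onD[OF f, of y "y + (q - p)"] pq(3) by (simp add: linear_add[OF pi] linear_diff[OF pi])
  ultimately show "dd F p v = dd F q v"
    using has_derivative_eq_on_open[of ?D p F "\<lambda>y. F (y + (q - p))"] smooth_on_has_derivative[OF F pq(1)]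
    by metis
qed

lemma factors_on_dd_eq_0:
  fixes F :: "'a::real_normed_vector \<Rightarrow> real"
  assumes D: "open D" and F: "smooth_on D F" and pi: "linear \<pi>" and f: "factors_on D \<pi> F"
    and p: "p \<in> D" and v: "\<pi> v = 0"
  shows "dd F p v = 0"
proof -
  obtain r where r: "r > 0" "\<And>s. \<bar>s\<bar> < r \<Longrightarrow> p + s *\<^sub>R v \<in> D"
    using open_line[OF D p, of v] by blast
  have *: "((\<lambda>s. p + s *\<^sub>R v) has_derivative (\<lambda>s. s *\<^sub>R v)) (at 0)"
    by (auto intro!: derivative_eq_intros)
  have "((\<lambda>s. F (p + s *\<^sub>R v)) has_derivative (\<lambda>s. dd F p (s *\<^sub>R v))) (at 0)"
    by (rule has_derivative_compose[OF *]) (use smooth_on_has_derivative[OF F p] in simp)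
  then have "((\<lambda>s. F (p + s *\<^sub>R v)) has_real_derivative dd F p v) (at 0)"
    using smooth_on_linear_frechet_derivative[OF F p]
    by (simp add: has_field_derivative_def linear_scale mult_commute_abs)
  moreover have "\<forall>y. \<bar>0 - y\<bar> < r \<longrightarrow> F (p + 0 *\<^sub>R v) = F (p + y *\<^sub>R v)"
    using factors_onD[OF f p] r v by (simp add: linear_add[OF pi] linear_scale[OF pi])
  ultimately show ?thesis
    using DERIV_local_const r(1) by blast
qed

text \<open>Mean value theorem on the segment from \<open>p\<close> to \<open>q\<close>: convexity
  keeps it in \<open>D\<close>, and its direction lies in the kernel of
  \<open>\<pi>\<close>.\<close>

lemma factors_onI_dd:
  fixes F :: "'a::real_normed_vector \<Rightarrow> real"
  assumes D: "convex D" and F: "smooth_on D F" and pi: "linear \<pi>"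
    and 0: "\<And>p v. p \<in> D \<Longrightarrow> \<pi> v = 0 \<Longrightarrow> dd F p v = 0"
  shows "factors_on D \<pi> F"
  unfolding factors_on_def
proof (intro ballI impI)
  fix p q assume pq: "p \<in> D" "q \<in> D" "\<pi> p = \<pi> q"
  have in_D: "p + s *\<^sub>R (q - p) \<in> D" if "s \<in> {0..1}" for s
    using that convexD[OF D pq(1,2), of "1 - s" s] by (simp add: algebra_simps)
  have *: "((\<lambda>s. p + s *\<^sub>R (q - p)) has_derivative (\<lambda>s. s *\<^sub>R (q - p))) (at s within {0..1})" for s
    by (auto intro!: derivative_eq_intros)
  have "((\<lambda>s. F (p + s *\<^sub>R (q - p))) has_derivative (\<lambda>h. dd F (p + s *\<^sub>R (q - p)) (h *\<^sub>R (q - p))))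
    (at s within {0..1})" if "s \<in> {0..1}" for s
    by (rule has_derivative_compose[OF * smooth_on_has_derivative[OF F in_D[OF that]]])
  then obtain s where s: "s \<in> {0<..<1}" "F (p + 1 *\<^sub>R (q - p)) - F (p + 0 *\<^sub>R (q - p)) =
      dd F (p + s *\<^sub>R (q - p)) ((1 - 0) *\<^sub>R (q - p))"
    using mvt_simple[of 0 1 "\<lambda>s. F (p + s *\<^sub>R (q - p))" "\<lambda>s h. dd F (p + s *\<^sub>R (q - p)) (h *\<^sub>R (q - p))"]
    by auto
  then show "F p = F q"
    using 0[OF in_D[of s], of "q - p"] pq(3) by (simp add: linear_diff[OF pi])
qed

text \<open>The vector \<open>e\<close> provides local affine sections of \<open>l\<close>, and
  along such a section \<open>F\<close> is the desired function of one variable, so smoothness is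
  inherited. The choice in the definition of \<open>f\<close> is harmless because \<open>F\<close>
  is constant on fibres.\<close>

lemma factors_on_real_smooth:
  fixes F :: "'a::euclidean_space \<Rightarrow> real" and l :: "'a \<Rightarrow> real"
  assumes D: "open D" and F: "smooth_on D F" and l: "linear l" "l e = 1" and f: "factors_on D l F"
  obtains f where "smooth_on (l ` D) f" "\<And>p. p \<in> D \<Longrightarrow> F p = f (l p)"
proof
  define f where "f r = F (SOME p. p \<in> D \<and> l p = r)" for r
  show eq: "F p = f (l p)" if "p \<in> D" for p
  proof -
    have "(SOME q. q \<in> D \<and> l q = l p) \<in> D \<and> l (SOME q. q \<in> D \<and> l q = l p) = l p"
      using that by (metis (mono_tags, lifting) someI_ex)
    then show ?thesis unfolding f_def using factors_onD[OF f] that by metis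
  qed
  show "smooth_on (l ` D) f"
  proof (rule smooth_on_local)
    fix a assume "a \<in> l ` D"
    then obtain p where p: "p \<in> D" "a = l p" by auto
    obtain r where r: "r > 0" "\<And>s. \<bar>s\<bar> < r \<Longrightarrow> p + s *\<^sub>R e \<in> D"
      using open_line[OF D p(1), of e] by blast
    have in_D: "(p - a *\<^sub>R e) + s *\<^sub>R e \<in> D" if "s \<in> ball a r" for s
      using r(2)[of "s - a"] that by (simp add: dist_real_def algebra_simps abs_minus_commute)
    have "smooth_on (ball a r) (\<lambda>s. (p - a *\<^sub>R e) + s *\<^sub>R e)"
      by (intro smooth_on_add smooth_on_const smooth_on_linear bounded_linear_scaleR_left) auto
    then have "smooth_on (ball a r) (\<lambda>s. F ((p - a *\<^sub>R e) + s *\<^sub>R e))"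
      by (rule smooth_on_compose[OF F D open_ball _ in_D])
    moreover have "F ((p - a *\<^sub>R e) + s *\<^sub>R e) = f s" if "s \<in> ball a r" for s
      using eq[OF in_D[OF that]] p l by (simp add: linear_add linear_scale linear_diff)
    ultimately have "smooth_on (ball a r) f"
      by (rule iffD1[OF smooth_on_cong[OF open_ball], rotated])
    then show "\<exists>U. open U \<and> a \<in> U \<and> smooth_on U f"
      using r(1) by (intro exI[of _ "ball a r"]) auto
  qed
qed

text \<open>Displacements that stay in \<open>D\<close> are small, so coefficients have to be read
  off near \<open>0\<close>; the values at \<open>0\<close>, \<open>r / 2\<close> and
  \<open>- (r / 2)\<close> suffice.\<close>

lemma quadratic_eq_0_near_0:
  fixes a b c r :: real
  assumes "r > 0" "\<And>s. \<bar>s\<bar> < r \<Longrightarrow> a + b * s + c * s\<^sup>2 = 0"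
  shows "a = 0" "b = 0" "c = 0"
proof -
  show a: "a = 0" using assms(2)[of 0] assms(1) by simp
  have "b * (r / 2) + c * (r / 2)\<^sup>2 = 0" "- (b * (r / 2)) + c * (r / 2)\<^sup>2 = 0"
    using assms(2)[of "r / 2"] assms(2)[of "- (r / 2)"] assms(1) a by auto
  then have "b * (r / 2) = 0" "c * (r / 2)\<^sup>2 = 0" by linarith+
  then show "b = 0" "c = 0" using assms(1) by auto
qed

subsection \<open>Analysis of an element of the equivalence group\<close>

abbreviation base_of :: "ext \<Rightarrow> base" where "base_of p \<equiv> fst (fst p)"
abbreviation t_of :: "ext \<Rightarrow> real" where "t_of p \<equiv> fst (fst (fst p))"
abbreviation x_of :: "ext \<Rightarrow> real" where "x_of p \<equiv> fst (snd (fst (fst p)))"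
abbreviation u_of :: "ext \<Rightarrow> real" where "u_of p \<equiv> snd (snd (fst (fst p)))"
abbreviation ut_of :: "ext \<Rightarrow> real" where "ut_of p \<equiv> fst (fst (snd (fst p)))"
abbreviation ux_of :: "ext \<Rightarrow> real" where "ux_of p \<equiv> snd (fst (snd (fst p)))"
abbreviation utt_of :: "ext \<Rightarrow> real" where "utt_of p \<equiv> fst (snd (snd (fst p)))"
abbreviation utx_of :: "ext \<Rightarrow> real" where "utx_of p \<equiv> fst (snd (snd (snd (fst p))))"
abbreviation uxx_of :: "ext \<Rightarrow> real" where "uxx_of p \<equiv> snd (snd (snd (snd (fst p))))"
abbreviation b_of :: "ext \<Rightarrow> real" where "b_of p \<equiv> snd p"

abbreviation e_t :: ext where "e_t \<equiv> (((1, 0, 0), (0, 0), (0, 0, 0)), 0)"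
abbreviation e_x :: ext where "e_x \<equiv> (((0, 1, 0), (0, 0), (0, 0, 0)), 0)"
abbreviation e_u :: ext where "e_u \<equiv> (((0, 0, 1), (0, 0), (0, 0, 0)), 0)"
abbreviation e_ut :: ext where "e_ut \<equiv> (((0, 0, 0), (1, 0), (0, 0, 0)), 0)"
abbreviation e_ux :: ext where "e_ux \<equiv> (((0, 0, 0), (0, 1), (0, 0, 0)), 0)"
abbreviation e_utt :: ext where "e_utt \<equiv> (((0, 0, 0), (0, 0), (1, 0, 0)), 0)"
abbreviation e_uxx :: ext where "e_uxx \<equiv> (((0, 0, 0), (0, 0), (0, 0, 1)), 0)"

text \<open>Total derivatives truncated to the second-order jet space. The Cartan plane leaves the
  second-order entries free, and \<open>0\<close> is chosen for them.\<close>

abbreviation D_t :: "ext \<Rightarrow> ext" where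
  "D_t p \<equiv> (((1, 0, ut_of p), (utt_of p, utx_of p), (0, 0, 0)), 0)"
abbreviation D_x :: "ext \<Rightarrow> ext" where
  "D_x p \<equiv> (((0, 1, ux_of p), (utx_of p, uxx_of p), (0, 0, 0)), 0)"

text \<open>The coordinate \<open>b_of p\<close> acts as a constant coefficient: the jet lies on the
  member of the class whose arbitrary element is constantly \<open>b_of p\<close>.\<close>

definition on_equation :: "real \<Rightarrow> ext \<Rightarrow> bool" where
  "on_equation \<epsilon> p \<longleftrightarrow> ut_of p = \<epsilon> * uxx_of p + b_of p * ux_of p"

lemma cartan_iff:
  "w \<in> cartan j \<longleftrightarrow>
     snd (snd (fst w)) = fst (fst (snd j)) * fst (fst w) + snd (fst (snd j)) * fst (snd (fst w)) \<and>
     fst (fst (snd w)) = fst (snd (snd j)) * fst (fst w) + fst (snd (snd (snd j))) * fst (snd (fst w)) \<and>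
     snd (fst (snd w)) = fst (snd (snd (snd j))) * fst (fst w) + snd (snd (snd (snd j))) * fst (snd (fst w))"
  by (cases w; cases j) (auto simp: cartan_def)

lemma kolmogorov_iff:
  "j \<in> kolmogorov \<epsilon> B \<longleftrightarrow>
     fst (fst (snd j)) = \<epsilon> * snd (snd (snd (snd j))) + B (tx_of j) * snd (fst (snd j))"
  by (cases j) (auto simp: kolmogorov_def tx_of_def)

lemma tx_of_eq: "tx_of j = (fst (fst j), fst (snd (fst j)))"
  by (cases j) (auto simp: tx_of_def)

lemma time_range_eq: "time_range D = t_of ` D"
  by (force simp: time_range_def image_iff)

locale kolmogorov_equivalence =
  fixes \<epsilon> :: real and D :: "ext set" and \<Phi> :: "ext \<Rightarrow> ext"
  assumes eps: "\<epsilon> \<noteq> 0"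
    and local_domain: "local_domain \<epsilon> D"
    and equiv: "\<Phi> \<in> equivalence_group \<epsilon> D"
begin

definition "ta p = t_of (\<Phi> p)"
definition "xi p = x_of (\<Phi> p)"
definition "mu p = u_of (\<Phi> p)"
definition "vt p = ut_of (\<Phi> p)"
definition "vx p = ux_of (\<Phi> p)"
definition "vtt p = utt_of (\<Phi> p)"
definition "vtx p = utx_of (\<Phi> p)"
definition "vxx p = uxx_of (\<Phi> p)"
definition "be p = b_of (\<Phi> p)"

lemmas comp_defs = ta_def xi_def mu_def vt_def vx_def vtt_def vtx_def vxx_def be_def

lemma openD: "open D" and convexD: "convex D"
  using local_domain by (auto simp: local_domain_def)

text \<open>Used whenever a relation between derivatives of the base components is to be carried
  from jets on the equation to an arbitrary point of \<open>D\<close>.\<close>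

lemma obtain_on_equation:
  assumes "p \<in> D"
  obtains q where "q \<in> D" "on_equation \<epsilon> q" "base_of q = base_of p" "b_of q = b_of p"
proof -
  have "(fst p, snd p) \<in> D" using assms by simp
  then obtain j where "fst j = fst (fst p)" "(j, snd p) \<in> D" "j \<in> kolmogorov \<epsilon> (\<lambda>_. snd p)"
    using local_domain unfolding local_domain_def by blast
  then show thesis
    by (intro that[of "(j, snd p)"]) (auto simp: kolmogorov_iff on_equation_def)
qed

lemma smooth_Phi: "smooth_on D \<Phi>"
  using equiv by (simp add: equivalence_group_def diffeo_on_def)

lemma smooth_comps:
  "smooth_on D ta" "smooth_on D xi" "smooth_on D mu" "smooth_on D vt" "smooth_on D vx"
  by (auto simp: comp_defs[abs_def] intro!: smooth_on_fst smooth_on_snd smooth_Phi openD)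

lemma dd_comps:
  assumes "p \<in> D"
  shows "dd ta p v = t_of (dd \<Phi> p v)" "dd xi p v = x_of (dd \<Phi> p v)" "dd mu p v = u_of (dd \<Phi> p v)"
    "dd vt p v = ut_of (dd \<Phi> p v)" "dd vx p v = ux_of (dd \<Phi> p v)"
proof -
  note d = smooth_on_has_derivative[OF smooth_Phi assms]
  show "dd ta p v = t_of (dd \<Phi> p v)" "dd xi p v = x_of (dd \<Phi> p v)" "dd mu p v = u_of (dd \<Phi> p v)"
    "dd vt p v = ut_of (dd \<Phi> p v)" "dd vx p v = ux_of (dd \<Phi> p v)"
    unfolding comp_defs[abs_def]
    by (rule fun_cong[OF frechet_derivative_at[symmetric]], intro has_derivative_fst has_derivative_snd d)+
qed

section \<open>Contact conditions and nondegeneracy\<close>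

lemma contact:
  assumes p: "p \<in> D" and v: "fst v \<in> cartan (fst p)"
  shows "dd mu p v = vt p * dd ta p v + vx p * dd xi p v"
    "dd vt p v = vtt p * dd ta p v + vtx p * dd xi p v"
    "dd vx p v = vtx p * dd ta p v + vxx p * dd xi p v"
proof -
  have "fst (dd \<Phi> p v) \<in> cartan (fst (\<Phi> p))"
    using equiv p v unfolding equivalence_group_def contact_on_def by blast
  then show "dd mu p v = vt p * dd ta p v + vx p * dd xi p v"
    "dd vt p v = vtt p * dd ta p v + vtx p * dd xi p v"
    "dd vx p v = vtx p * dd ta p v + vxx p * dd xi p v"
    unfolding dd_comps[OF p] unfolding cartan_iff comp_defs by simp_all
qed

text \<open>The smooth left inverse makes the derivative injective; equality of dimensions does the
  rest.\<close>

lemma surj_dd: "p \<in> D \<Longrightarrow> surj (dd \<Phi> p)"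
proof -
  assume p: "p \<in> D"
  obtain g where g: "open (\<Phi> ` D)" "smooth_on (\<Phi> ` D) g" "\<And>x. x \<in> D \<Longrightarrow> g (\<Phi> x) = x"
    using equiv unfolding equivalence_group_def diffeo_on_def by blast
  note d = smooth_on_has_derivative[OF smooth_Phi p]
  have "((\<lambda>x. g (\<Phi> x)) has_derivative (\<lambda>v. dd g (\<Phi> p) (dd \<Phi> p v))) (at p)"
    by (rule has_derivative_compose[OF d]) (use smooth_on_has_derivative[OF g(2)] p in blast)
  then have "dd g (\<Phi> p) (dd \<Phi> p v) = v" for v
    using has_derivative_eq_on_open[OF openD p g(3) _ has_derivative_ident] by blast
  then have "inj (dd \<Phi> p)" by (metis injI)
  then show ?thesis
    using linear_injective_imp_surjective has_derivative_linear[OF d] by blast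
qed

text \<open>A linear relation between the three differentials can be tested on preimages of
  \<open>e_t\<close>, \<open>e_x\<close>, \<open>e_u\<close> under the surjective derivative of
  \<open>\<Phi>\<close>.\<close>

lemma nondegenerate_all:
  assumes p: "p \<in> D" and z: "\<And>v. \<alpha> * dd ta p v + \<gamma> * dd xi p v + \<delta> * dd mu p v = 0"
  shows "\<alpha> = 0" "\<gamma> = 0" "\<delta> = 0"
proof -
  have "\<alpha> * t_of w + \<gamma> * x_of w + \<delta> * u_of w = 0" for w
  proof -
    obtain v where "w = dd \<Phi> p v" using surjD[OF surj_dd[OF p]] by blast
    then show ?thesis using z[of v] dd_comps[OF p] by simp
  qed
  from this[of e_t] this[of e_x] this[of e_u] show "\<alpha> = 0" "\<gamma> = 0" "\<delta> = 0" by simp_all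
qed

section \<open>Dependence of the components on the base and on the first-order jet\<close>

lemma linear_base: "linear base_of"
  by (intro bounded_linear.linear bounded_linear_intros)

lemma base_factor: "factors_on D base_of ta" "factors_on D base_of xi" "factors_on D base_of mu"
proof -
  obtain \<phi> :: "base \<Rightarrow> base" where "\<And>p. p \<in> D \<Longrightarrow> base_of (\<Phi> p) = \<phi> (base_of p)"
    using equiv unfolding equivalence_group_def projectable_on_def by fastforce
  then show "factors_on D base_of ta" "factors_on D base_of xi" "factors_on D base_of mu"
    unfolding factors_on_def comp_defs by metis+
qed

lemma dd_base:
  assumes F: "smooth_on D F" "factors_on D base_of F" and p: "p \<in> D"
  shows "dd F p v = t_of v * dd F p e_t + x_of v * dd F p e_x + u_of v * (dd F p e_u :: real)"
proof -
  note l = smooth_on_linear_frechet_derivative[OF F(1) p]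
  let ?w = "t_of v *\<^sub>R e_t + x_of v *\<^sub>R e_x + u_of v *\<^sub>R e_u"
  have "dd F p (v - ?w) = 0"
    by (rule factors_on_dd_eq_0[OF openD F(1) linear_base F(2) p]) (simp add: prod_eq_iff)
  then have "dd F p v = dd F p ?w" by (simp add: linear_diff[OF l])
  also have "\<dots> = t_of v * dd F p e_t + x_of v * dd F p e_x + u_of v * dd F p e_u"
    by (simp only: linear_add[OF l] linear_scale[OF l] real_scaleR_def)
  finally show ?thesis .
qed

lemmas dd_base_comps = dd_base[OF smooth_comps(1) base_factor(1)] dd_base[OF smooth_comps(2) base_factor(2)]
  dd_base[OF smooth_comps(3) base_factor(3)]

lemma nondegenerate:
  assumes p: "p \<in> D"
    and "\<alpha> * dd ta p e_t + \<gamma> * dd xi p e_t + \<delta> * dd mu p e_t = 0"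
    and "\<alpha> * dd ta p e_x + \<gamma> * dd xi p e_x + \<delta> * dd mu p e_x = 0"
    and "\<alpha> * dd ta p e_u + \<gamma> * dd xi p e_u + \<delta> * dd mu p e_u = 0"
  shows "\<alpha> = 0" "\<gamma> = 0" "\<delta> = 0"
proof -
  have "\<alpha> * dd ta p v + \<gamma> * dd xi p v + \<delta> * dd mu p v =
      t_of v * (\<alpha> * dd ta p e_t + \<gamma> * dd xi p e_t + \<delta> * dd mu p e_t) +
      x_of v * (\<alpha> * dd ta p e_x + \<gamma> * dd xi p e_x + \<delta> * dd mu p e_x) +
      u_of v * (\<alpha> * dd ta p e_u + \<gamma> * dd xi p e_u + \<delta> * dd mu p e_u)" for v
    unfolding dd_base_comps[OF p, of v] by (simp add: algebra_simps)
  then have "\<alpha> * dd ta p v + \<gamma> * dd xi p v + \<delta> * dd mu p v = 0" for v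
    unfolding assms(2-) by simp
  from nondegenerate_all[OF p this] show "\<alpha> = 0" "\<gamma> = 0" "\<delta> = 0" .
qed

lemma contact_mu:
  assumes p: "p \<in> D"
  shows "dd mu p e_t + ut_of p * dd mu p e_u =
      vt p * (dd ta p e_t + ut_of p * dd ta p e_u) + vx p * (dd xi p e_t + ut_of p * dd xi p e_u)"
    and "dd mu p e_x + ux_of p * dd mu p e_u =
      vt p * (dd ta p e_x + ux_of p * dd ta p e_u) + vx p * (dd xi p e_x + ux_of p * dd xi p e_u)"
  using contact(1)[OF p, of "D_t p"] contact(1)[OF p, of "D_x p"]
  unfolding dd_base_comps[OF p, of "D_t p"] dd_base_comps[OF p, of "D_x p"]
  by (simp_all add: cartan_iff)

text \<open>The expression is the value on \<open>e_u\<close> of the form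
  \<open>d\<mu> - vt d\<tau> - vx d\<xi>\<close>. By \<open>contact_mu\<close> this form vanishes on
  the base parts of \<open>D_t p\<close> and \<open>D_x p\<close>; vanishing on \<open>e_u\<close>
  as well would make the differentials of the base components dependent.\<close>

lemma vertical_contact_nz:
  assumes p: "p \<in> D"
  shows "dd mu p e_u - vt p * dd ta p e_u - vx p * dd xi p e_u \<noteq> 0"
proof
  assume K: "dd mu p e_u - vt p * dd ta p e_u - vx p * dd xi p e_u = 0"
  have "(1::real) = 0"
  proof (rule nondegenerate(3)[OF p])
    show "(- vt p) * dd ta p e_t + (- vx p) * dd xi p e_t + 1 * dd mu p e_t = 0"
      using contact_mu(1)[OF p] K by algebra
    show "(- vt p) * dd ta p e_x + (- vx p) * dd xi p e_x + 1 * dd mu p e_x = 0"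
      using contact_mu(2)[OF p] K by algebra
  qed (use K in simp)
  then show False by simp
qed

abbreviation jet1_of :: "ext \<Rightarrow> base \<times> (real \<times> real)" where
  "jet1_of p \<equiv> (fst (fst p), fst (snd (fst p)))"

lemma linear_jet1: "linear jet1_of"
  by (intro bounded_linear.linear bounded_linear_intros)

text \<open>Directions that change only second-order derivatives and B lie in the Cartan plane and
  annihilate \<open>ta\<close> and \<open>xi\<close>, so the contact conditions leave nothing on
  their right-hand sides.\<close>

lemma jet1_factor: "factors_on D jet1_of vt" "factors_on D jet1_of vx"
proof -
  have *: "fst v \<in> cartan (fst p) \<and> dd ta p v = 0 \<and> dd xi p v = 0"
    if "p \<in> D" "jet1_of v = 0" for p v
    using that unfolding dd_base_comps[OF that(1), of v]
    by (auto simp: cartan_iff prod_eq_iff)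
  show "factors_on D jet1_of vt" "factors_on D jet1_of vx"
    by (rule factors_onI_dd[OF convexD _ linear_jet1]; use smooth_comps contact * in simp)+
qed

lemma dd_jet1:
  assumes F: "smooth_on D F" "factors_on D jet1_of F" and p: "p \<in> D"
  shows "dd F p v = t_of v * dd F p e_t + x_of v * dd F p e_x + u_of v * (dd F p e_u :: real)
    + ut_of v * dd F p e_ut + ux_of v * dd F p e_ux"
proof -
  note l = smooth_on_linear_frechet_derivative[OF F(1) p]
  let ?w = "t_of v *\<^sub>R e_t + x_of v *\<^sub>R e_x + u_of v *\<^sub>R e_u + ut_of v *\<^sub>R e_ut + ux_of v *\<^sub>R e_ux"
  have "dd F p (v - ?w) = 0"
    by (rule factors_on_dd_eq_0[OF openD F(1) linear_jet1 F(2) p]) (simp add: prod_eq_iff)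
  then have "dd F p v = dd F p ?w" by (simp add: linear_diff[OF l])
  also have "\<dots> = t_of v * dd F p e_t + x_of v * dd F p e_x + u_of v * dd F p e_u
    + ut_of v * dd F p e_ut + ux_of v * dd F p e_ux"
    by (simp only: linear_add[OF l] linear_scale[OF l] real_scaleR_def)
  finally show ?thesis .
qed

lemmas dd_jet1_comps = dd_jet1[OF smooth_comps(4) jet1_factor(1)] dd_jet1[OF smooth_comps(5) jet1_factor(2)]

lemma contact_vx:
  assumes p: "p \<in> D"
  shows "dd vx p e_t + ut_of p * dd vx p e_u + utt_of p * dd vx p e_ut + utx_of p * dd vx p e_ux =
      vtx p * (dd ta p e_t + ut_of p * dd ta p e_u) + vxx p * (dd xi p e_t + ut_of p * dd xi p e_u)"
    and "dd vx p e_x + ux_of p * dd vx p e_u + utx_of p * dd vx p e_ut + uxx_of p * dd vx p e_ux =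
      vtx p * (dd ta p e_x + ux_of p * dd ta p e_u) + vxx p * (dd xi p e_x + ux_of p * dd xi p e_u)"
  using contact(3)[OF p, of "D_t p"] contact(3)[OF p, of "D_x p"]
  unfolding dd_base_comps[OF p, of "D_t p"] dd_base_comps[OF p, of "D_x p"]
    dd_jet1_comps[OF p, of "D_t p"] dd_jet1_comps[OF p, of "D_x p"]
  by (simp_all add: cartan_iff)

text \<open>Preservation of the class is applied to the constant function with value
  \<open>b_of p\<close>. In the second claim the new value is read from one function of the new
  \<open>(t, x)\<close>, and these depend on the base only.\<close>

lemma transformed_equation:
  assumes "p \<in> D" "on_equation \<epsilon> p"
  shows "vt p = \<epsilon> * vxx p + be p * vx p"
    and "q \<in> D \<Longrightarrow> base_of q = base_of p \<Longrightarrow> b_of q = b_of p \<Longrightarrow> be q = be p"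
proof -
  have "smooth_on UNIV (\<lambda>_ :: real \<times> real. b_of p)" by (simp add: smooth_on_const)
  moreover have "preserves_class_on \<epsilon> D \<Phi>" using equiv by (simp add: equivalence_group_def)
  ultimately obtain B' where "\<forall>j. (j, b_of p) \<in> D \<longrightarrow>
      snd (\<Phi> (j, b_of p)) = B' (tx_of (fst (\<Phi> (j, b_of p)))) \<and>
         (j \<in> kolmogorov \<epsilon> (\<lambda>_. b_of p) \<longleftrightarrow> fst (\<Phi> (j, b_of p)) \<in> kolmogorov \<epsilon> B')"
    unfolding preserves_class_on_def split_beta by (metis UNIV_I open_UNIV)
  then have *: "snd (\<Phi> q) = B' (tx_of (fst (\<Phi> q))) \<and>
         (fst q \<in> kolmogorov \<epsilon> (\<lambda>_. b_of p) \<longleftrightarrow> fst (\<Phi> q) \<in> kolmogorov \<epsilon> B')"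
    if "q \<in> D" "b_of q = b_of p" for q
    using that by (metis prod.collapse)
  have be: "be q = B' (ta q, xi q)" if "q \<in> D" "b_of q = b_of p" for q
    using *[OF that] by (simp add: comp_defs tx_of_eq)
  show "vt p = \<epsilon> * vxx p + be p * vx p"
    using *[OF assms(1)] assms(2)
    by (simp add: comp_defs kolmogorov_iff on_equation_def tx_of_eq)
  show "be q = be p" if "q \<in> D" "base_of q = base_of p" "b_of q = b_of p"
    using be[of p] be[OF that(1,3)] factors_onD[OF base_factor(1), of p q]
      factors_onD[OF base_factor(2), of p q] that assms(1) by auto
qed

lemmas smooth_dd_comps = smooth_comps[THEN smooth_on_frechet_derivative]

lemma dd_dd_base_eq_0:
  assumes "p \<in> D" "base_of v = 0"
  shows "dd (\<lambda>q. dd ta q w) p v = 0" "dd (\<lambda>q. dd xi q w) p v = 0" "dd (\<lambda>q. dd mu q w) p v = 0"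
  by (rule factors_on_dd_eq_0[OF openD _ linear_base factors_on_dd[OF openD _ linear_base]];
      use assms smooth_comps smooth_dd_comps base_factor in blast)+

lemma has_derivative_ut_ux:
  "(ut_of has_derivative ut_of) (at p)" "(ux_of has_derivative ux_of) (at p)"
  by (intro bounded_linear_imp_has_derivative bounded_linear_intros)+

text \<open>These are derivatives of the identities \<open>contact_mu\<close> in the directions
  \<open>e_ut\<close> and \<open>e_ux\<close>, along which the first derivatives of the base
  components are constant.\<close>

lemma contact_mu_vertical:
  assumes p: "p \<in> D"
  shows "dd mu p e_u =
      dd vt p e_ut * (dd ta p e_t + ut_of p * dd ta p e_u) + vt p * dd ta p e_u +
      dd vx p e_ut * (dd xi p e_t + ut_of p * dd xi p e_u) + vx p * dd xi p e_u"
    and "dd vt p e_ut * (dd ta p e_x + ux_of p * dd ta p e_u) +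
      dd vx p e_ut * (dd xi p e_x + ux_of p * dd xi p e_u) = 0"
    and "dd mu p e_u =
      dd vt p e_ux * (dd ta p e_x + ux_of p * dd ta p e_u) + vt p * dd ta p e_u +
      dd vx p e_ux * (dd xi p e_x + ux_of p * dd xi p e_u) + vx p * dd xi p e_u"
proof -
  note hd = smooth_dd_comps[THEN smooth_on_has_derivative, OF p]
  note hv = smooth_comps[THEN smooth_on_has_derivative, OF p]
  note 1 = has_derivative_eq_on_open[OF openD p contact_mu(1)
      has_derivative_add[OF hd(3) has_derivative_mult[OF has_derivative_ut_ux(1) hd(3)]]
      has_derivative_add[OF
        has_derivative_mult[OF hv(4) has_derivative_add[OF hd(1) has_derivative_mult[OF has_derivative_ut_ux(1) hd(1)]]]
        has_derivative_mult[OF hv(5) has_derivative_add[OF hd(2) has_derivative_mult[OF has_derivative_ut_ux(1) hd(2)]]]]]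
  note 2 = has_derivative_eq_on_open[OF openD p contact_mu(2)
      has_derivative_add[OF hd(3) has_derivative_mult[OF has_derivative_ut_ux(2) hd(3)]]
      has_derivative_add[OF
        has_derivative_mult[OF hv(4) has_derivative_add[OF hd(1) has_derivative_mult[OF has_derivative_ut_ux(2) hd(1)]]]
        has_derivative_mult[OF hv(5) has_derivative_add[OF hd(2) has_derivative_mult[OF has_derivative_ut_ux(2) hd(2)]]]]]
  note z = dd_dd_base_eq_0[OF p]
  show "dd mu p e_u =
      dd vt p e_ut * (dd ta p e_t + ut_of p * dd ta p e_u) + vt p * dd ta p e_u +
      dd vx p e_ut * (dd xi p e_t + ut_of p * dd xi p e_u) + vx p * dd xi p e_u"
    using 1[of e_ut] by (simp add: z zero_prod_def algebra_simps)
  show "dd vt p e_ut * (dd ta p e_x + ux_of p * dd ta p e_u) +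
      dd vx p e_ut * (dd xi p e_x + ux_of p * dd xi p e_u) = 0"
    using 2[of e_ut] by (simp add: z zero_prod_def algebra_simps)
  show "dd mu p e_u =
      dd vt p e_ux * (dd ta p e_x + ux_of p * dd ta p e_u) + vt p * dd ta p e_u +
      dd vx p e_ux * (dd xi p e_x + ux_of p * dd xi p e_u) + vx p * dd xi p e_u"
    using 2[of e_ux] by (simp add: z zero_prod_def algebra_simps)
qed

lemma dd_comps_base_cong:
  assumes "p \<in> D" "q \<in> D" "base_of p = base_of q"
  shows "dd ta p v = dd ta q v" "dd xi p v = dd xi q v" "dd mu p v = dd mu q v"
  by (rule factors_onD[OF factors_on_dd[OF openD _ linear_base] assms]; use smooth_comps base_factor in blast)+

section \<open>The new time depends on time only\<close>

text \<open>A change of \<open>u\<^sub>t\<^sub>t\<close> alone keeps the jet on the equation and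
  keeps \<open>vt\<close>, \<open>vx\<close> and \<open>be\<close>, hence also \<open>vxx\<close>.
  If the total x-derivative of \<open>ta\<close> were nonzero, the \<open>D_x\<close>-identity for
  \<open>vx\<close> would fix \<open>vtx\<close> too, and the \<open>D_t\<close>-identity would then
  force \<open>dd vx p e_ut = 0\<close>. The vertical identities turn this into
  \<open>dd vt p e_ut = 0\<close> and finally contradict \<open>vertical_contact_nz\<close>.\<close>

lemma ta_Dx_eq_0:
  assumes p: "p \<in> D" and eq: "on_equation \<epsilon> p"
  shows "dd ta p e_x + ux_of p * dd ta p e_u = 0"
proof (rule ccontr)
  assume nz: "dd ta p e_x + ux_of p * dd ta p e_u \<noteq> 0"
  obtain r where r: "r > 0" "\<And>s. \<bar>s\<bar> < r \<Longrightarrow> p + s *\<^sub>R e_utt \<in> D"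
    using open_line[OF openD p, of e_utt] by blast
  define s where "s = r / 2"
  define q where "q = p + s *\<^sub>R e_utt"
  have "s \<noteq> 0" "\<bar>s\<bar> < r" using r(1) by (auto simp: s_def)
  then have s: "s \<noteq> 0" and q: "q \<in> D" unfolding q_def by (blast intro: r(2))+
  have c: "base_of q = base_of p" "jet1_of q = jet1_of p" "b_of q = b_of p" "on_equation \<epsilon> q"
    "ut_of q = ut_of p" "ux_of q = ux_of p" "utt_of q = utt_of p + s" "utx_of q = utx_of p" "uxx_of q = uxx_of p"
    using eq by (simp_all add: q_def on_equation_def prod_eq_iff)
  have v: "vt q = vt p" "vx q = vx p"
    using factors_onD[OF jet1_factor(1) q p c(2)] factors_onD[OF jet1_factor(2) q p c(2)] by auto
  have d: "dd vx q w = dd vx p w" for w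
    by (rule factors_onD[OF factors_on_dd[OF openD smooth_comps(5) linear_jet1 jet1_factor(2)] q p c(2)])
  have "vxx q = vxx p"
    using transformed_equation(1)[OF p eq] transformed_equation(1)[OF q c(4)] eps
      transformed_equation(2)[OF p eq q c(1,3)] v by simp
  moreover have "vtx q * (dd ta p e_x + ux_of p * dd ta p e_u) + vxx q * (dd xi p e_x + ux_of p * dd xi p e_u)
      = vtx p * (dd ta p e_x + ux_of p * dd ta p e_u) + vxx p * (dd xi p e_x + ux_of p * dd xi p e_u)"
    using contact_vx(2)[OF p] contact_vx(2)[OF q] unfolding d c dd_comps_base_cong[OF q p c(1)] by simp
  ultimately have *: "vtx q = vtx p" "vxx q = vxx p" using nz by auto
  have "s * dd vx p e_ut = 0"
    using contact_vx(1)[OF p] contact_vx(1)[OF q]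
    unfolding d c dd_comps_base_cong[OF q p c(1)] * by algebra
  then have ut: "dd vx p e_ut = 0" using s by simp
  then have "dd vt p e_ut = 0" using contact_mu_vertical(2)[OF p] nz by simp
  then show False using contact_mu_vertical(1)[OF p] ut vertical_contact_nz[OF p] by simp
qed

lemma ta_x: "p \<in> D \<Longrightarrow> dd ta p e_x = 0" and ta_u: "p \<in> D \<Longrightarrow> dd ta p e_u = 0"
proof -
  assume p: "p \<in> D"
  obtain q where q: "q \<in> D" "on_equation \<epsilon> q" "base_of q = base_of p" by (rule obtain_on_equation[OF p])
  \<comment> \<open>With \<open>u\<^sub>x\<^sub>x\<close> kept fixed, staying on the equation
    requires \<open>u\<^sub>t\<close> to change by B times the change of
    \<open>u\<^sub>x\<close>.\<close>
  let ?v = "e_ux + b_of q *\<^sub>R e_ut"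
  obtain r where r: "r > 0" "\<And>s. \<bar>s\<bar> < r \<Longrightarrow> q + s *\<^sub>R ?v \<in> D"
    using open_line[OF openD q(1), of ?v] by blast
  have *: "(dd ta p e_x + ux_of q * dd ta p e_u) + dd ta p e_u * s + 0 * s\<^sup>2 = 0" if s: "\<bar>s\<bar> < r" for s
  proof -
    have "on_equation \<epsilon> (q + s *\<^sub>R ?v)"
      using q(2) by (simp add: on_equation_def algebra_simps)
    moreover have b: "base_of (q + s *\<^sub>R ?v) = base_of p" "ux_of (q + s *\<^sub>R ?v) = ux_of q + s"
      using q(3) by (simp_all add: prod_eq_iff)
    ultimately show ?thesis
      using ta_Dx_eq_0[OF r(2)[OF s]] unfolding b dd_comps_base_cong[OF r(2)[OF s] p b(1)]
      by (simp add: algebra_simps power2_eq_square)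
  qed
  show "dd ta p e_x = 0" "dd ta p e_u = 0"
    using quadratic_eq_0_near_0[OF r(1) *] by auto
qed

lemma ta_t_nz: "p \<in> D \<Longrightarrow> dd ta p e_t \<noteq> 0"
  using nondegenerate(1)[of p 1 0 0] ta_x ta_u by auto

section \<open>The new space variable is affine in x and does not involve u\<close>

text \<open>Otherwise all three base components would have zero derivative along
  \<open>D_x p\<close>: \<open>ta\<close> by what is already known, \<open>mu\<close> by the contact
  condition. Since \<open>nondegenerate\<close> speaks of relations between differentials, the
  contradiction is reached through an explicit relation.\<close>

lemma xi_Dx_nz:
  assumes p: "p \<in> D"
  shows "dd xi p e_x + ux_of p * dd xi p e_u \<noteq> 0"
proof
  assume z: "dd xi p e_x + ux_of p * dd xi p e_u = 0"
  \<comment> \<open>\<open>c\<close> removes the \<open>u\<close>-component of \<open>d\<xi>\<close> by a multiple of the contact form, \<open>\<alpha>\<close> the remaining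
    \<open>t\<close>-component by a multiple of \<open>d\<tau>\<close>.\<close>
  define c where "c = dd xi p e_u / (dd mu p e_u - vx p * dd xi p e_u)"
  have c: "c * (dd mu p e_u - vx p * dd xi p e_u) = dd xi p e_u"
    using vertical_contact_nz[OF p] ta_u[OF p] by (simp add: c_def)
  define \<alpha> where "\<alpha> = - ((1 + c * vx p) * dd xi p e_t - c * dd mu p e_t) / dd ta p e_t"
  have 1: "\<alpha> * dd ta p e_t + (1 + c * vx p) * dd xi p e_t + (- c) * dd mu p e_t = 0"
    using ta_t_nz[OF p] by (simp add: \<alpha>_def)
  have 2: "\<alpha> * dd ta p e_x + (1 + c * vx p) * dd xi p e_x + (- c) * dd mu p e_x = 0"
    using contact_mu(2)[OF p] z c unfolding ta_x[OF p] ta_u[OF p] by algebra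
  have 3: "\<alpha> * dd ta p e_u + (1 + c * vx p) * dd xi p e_u + (- c) * dd mu p e_u = 0"
    using c unfolding ta_u[OF p] by (simp add: algebra_simps)
  \<comment> \<open>The coefficients of \<open>d\<xi>\<close> and \<open>d\<mu>\<close> would both
    vanish, but \<open>c = 0\<close> excludes \<open>1 + c * vx p = 0\<close>.\<close>
  show False using nondegenerate(2,3)[OF p 1 2 3] by auto
qed

lemma vx_ut: "p \<in> D \<Longrightarrow> dd vx p e_ut = 0"
  using contact_mu_vertical(2)[of p] xi_Dx_nz[of p] ta_x ta_u by simp

text \<open>The jet moves by \<open>s\<close> in \<open>u\<^sub>x\<^sub>x\<close> and by
  \<open>\<epsilon> * s\<close> in \<open>u\<^sub>t\<close>. With \<open>?X\<close> and
  \<open>?K\<close> as below, prolongation changes \<open>vxx\<close> by \<open>s ?K / ?X^2\<close>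
  and \<open>vt\<close> by \<open>\<epsilon> s ?K / dd ta p e_t\<close>, while the new equation
  demands that the second change be \<open>\<epsilon>\<close> times the first.\<close>

lemma xi_Dx_square:
  assumes p: "p \<in> D" and eq: "on_equation \<epsilon> p"
  shows "(dd xi p e_x + ux_of p * dd xi p e_u)\<^sup>2 = dd ta p e_t"
proof -
  let ?\<pi> = "\<lambda>p. (base_of p, ux_of p)"
  have lin: "linear ?\<pi>" by (intro bounded_linear.linear bounded_linear_intros)
  have fac: "factors_on D ?\<pi> vx"
  proof (rule factors_onI_dd[OF convexD smooth_comps(5) lin])
    fix q v assume "q \<in> D" "?\<pi> v = 0"
    then show "dd vx q v = 0"
      using dd_jet1_comps(2)[of q v] vx_ut[of q] by (simp add: prod_eq_iff)
  qed
  let ?v = "e_uxx + \<epsilon> *\<^sub>R e_ut"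
  obtain r where r: "r > 0" "\<And>s. \<bar>s\<bar> < r \<Longrightarrow> p + s *\<^sub>R ?v \<in> D"
    using open_line[OF openD p, of ?v] by blast
  define s where "s = r / 2"
  define q where "q = p + s *\<^sub>R ?v"
  have "s \<noteq> 0" "\<bar>s\<bar> < r" using r(1) by (auto simp: s_def)
  then have s: "s \<noteq> 0" and q: "q \<in> D" unfolding q_def by (blast intro: r(2))+
  have c: "base_of q = base_of p" "?\<pi> q = ?\<pi> p" "b_of q = b_of p" "on_equation \<epsilon> q"
    "ut_of q = ut_of p + \<epsilon> * s" "ux_of q = ux_of p" "utx_of q = utx_of p" "uxx_of q = uxx_of p + s"
    using eq by (simp_all add: q_def on_equation_def prod_eq_iff algebra_simps)
  have v: "vx q = vx p" using factors_onD[OF fac q p c(2)] .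
  have d: "dd vx q w = dd vx p w" for w
    by (rule factors_onD[OF factors_on_dd[OF openD smooth_comps(5) lin fac] q p c(2)])
  note simps = ta_x[OF p] ta_u[OF p] vx_ut[OF p]
  have 1: "vt q - vt p = \<epsilon> * (vxx q - vxx p)"
    using transformed_equation(1)[OF p eq] transformed_equation(1)[OF q c(4)]
      transformed_equation(2)[OF p eq q c(1,3)] v by (simp add: algebra_simps)
  have 2: "(vxx q - vxx p) * (dd xi p e_x + ux_of p * dd xi p e_u) = s * dd vx p e_ux"
    using contact_vx(2)[OF p] contact_vx(2)[OF q]
    unfolding d c dd_comps_base_cong[OF q p c(1)] simps by (simp add: algebra_simps)
  have 3: "(vt q - vt p) * dd ta p e_t = \<epsilon> * s * (dd mu p e_u - vx p * dd xi p e_u)"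
    using contact_mu(1)[OF p] contact_mu(1)[OF q]
    unfolding v c dd_comps_base_cong[OF q p c(1)] simps by (simp add: algebra_simps)
  have 4: "dd mu p e_u - vx p * dd xi p e_u = dd vx p e_ux * (dd xi p e_x + ux_of p * dd xi p e_u)"
    using contact_mu_vertical(3)[OF p] unfolding simps by simp
  let ?X = "dd xi p e_x + ux_of p * dd xi p e_u" and ?K = "dd mu p e_u - vx p * dd xi p e_u"
  have "(\<epsilon> * s * ?K) * ?X\<^sup>2 = (\<epsilon> * s * ?K) * dd ta p e_t"
    using 1 2 3 4 by algebra
  moreover have "\<epsilon> * s * ?K \<noteq> 0" using vertical_contact_nz[OF p] ta_u[OF p] eps s by simp
  ultimately show ?thesis by simp
qed

lemma xi_u: "p \<in> D \<Longrightarrow> dd xi p e_u = 0" and xi_x_square: "p \<in> D \<Longrightarrow> (dd xi p e_x)\<^sup>2 = dd ta p e_t"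
proof -
  assume p: "p \<in> D"
  obtain q where q: "q \<in> D" "on_equation \<epsilon> q" "base_of q = base_of p" by (rule obtain_on_equation[OF p])
  let ?v = "e_ux + b_of q *\<^sub>R e_ut"
  obtain r where r: "r > 0" "\<And>s. \<bar>s\<bar> < r \<Longrightarrow> q + s *\<^sub>R ?v \<in> D"
    using open_line[OF openD q(1), of ?v] by blast
  let ?X = "dd xi p e_x + ux_of q * dd xi p e_u"
  \<comment> \<open>The relation for the square, expanded in the displacement \<open>s\<close> of
    \<open>u\<^sub>x\<close>. The leading coefficient kills \<open>dd xi p e_u\<close>, after which
    the constant term is the second claim.\<close>
  have *: "(?X\<^sup>2 - dd ta p e_t) + (2 * ?X * dd xi p e_u) * s + (dd xi p e_u)\<^sup>2 * s\<^sup>2 = 0" if s: "\<bar>s\<bar> < r" for s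
  proof -
    have "on_equation \<epsilon> (q + s *\<^sub>R ?v)"
      using q(2) by (simp add: on_equation_def algebra_simps)
    moreover have b: "base_of (q + s *\<^sub>R ?v) = base_of p" "ux_of (q + s *\<^sub>R ?v) = ux_of q + s"
      using q(3) by (simp_all add: prod_eq_iff)
    ultimately show ?thesis
      using xi_Dx_square[OF r(2)[OF s]] unfolding b dd_comps_base_cong[OF r(2)[OF s] p b(1)]
      by (simp add: algebra_simps power2_eq_square)
  qed
  show "dd xi p e_u = 0" "(dd xi p e_x)\<^sup>2 = dd ta p e_t"
    using quadratic_eq_0_near_0[OF r(1) *] by auto
qed

lemma xi_x_nz: "p \<in> D \<Longrightarrow> dd xi p e_x \<noteq> 0"
  using xi_Dx_nz[of p] xi_u[of p] by simp

lemma linear_t: "linear t_of" and linear_u: "linear u_of"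
  by (intro bounded_linear.linear bounded_linear_intros)+

lemma ta_factor: "factors_on D t_of ta"
proof (rule factors_onI_dd[OF convexD smooth_comps(1) linear_t])
  show "dd ta p v = 0" if "p \<in> D" "t_of v = 0" for p v
    using dd_base_comps(1)[of p v] ta_x[of p] ta_u[of p] that by simp
qed

text \<open>Differentiate \<open>xi_x_square\<close>: its right-hand side depends on t only, and the
  factor \<open>dd xi p e_x\<close> that comes out on the left is nonzero.\<close>

lemma dd_xi_x: "p \<in> D \<Longrightarrow> t_of v = 0 \<Longrightarrow> dd (\<lambda>q. dd xi q e_x) p v = 0"
proof -
  assume p: "p \<in> D" and v: "t_of v = 0"
  note h = smooth_on_has_derivative[OF smooth_dd_comps(2) p, of e_x]
  have "dd (\<lambda>q. dd ta q e_t) p v = 0"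
    by (rule factors_on_dd_eq_0[OF openD smooth_dd_comps(1) linear_t
          factors_on_dd[OF openD smooth_comps(1) linear_t ta_factor] p v])
  then show ?thesis
    using has_derivative_eq_on_open[OF openD p xi_x_square[unfolded power2_eq_square]
        has_derivative_mult[OF h h] smooth_on_has_derivative[OF smooth_dd_comps(1) p], of v] xi_x_nz[OF p]
    by simp
qed

lemma xi_x_factor: "factors_on D t_of (\<lambda>q. dd xi q e_x)"
  by (rule factors_onI_dd[OF convexD smooth_dd_comps(2) linear_t dd_xi_x])

section \<open>The determining equation and the new dependent variable\<close>

lemma mu_u_nz: "p \<in> D \<Longrightarrow> dd mu p e_u \<noteq> 0"
  using vertical_contact_nz[of p] ta_u[of p] xi_u[of p] by simp

lemma dd_dd_mu:
  assumes "p \<in> D"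
  shows "dd (\<lambda>q. dd mu q w) p v = t_of v * dd (\<lambda>q. dd mu q w) p e_t +
    x_of v * dd (\<lambda>q. dd mu q w) p e_x + u_of v * dd (\<lambda>q. dd mu q w) p e_u"
  by (rule dd_base[OF smooth_dd_comps(3) factors_on_dd[OF openD smooth_comps(3) linear_base base_factor(3)] assms])

text \<open>This is the transformed equation multiplied by \<open>(dd xi p e_x)^3\<close>. The
  second-order component \<open>vxx\<close> comes from differentiating the formula for
  \<open>vx\<close> along \<open>D_x p\<close>, and \<open>vt\<close> from the
  \<open>D_t\<close>-identity. Once \<open>u\<^sub>t\<close> is eliminated by the original equation,
  the terms with \<open>u\<^sub>x\<^sub>x\<close> cancel, which leaves \<open>u\<^sub>x\<close> as
  the only derivative.\<close>

lemma determining_equation: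
  assumes p: "p \<in> D" and eq: "on_equation \<epsilon> p"
  shows "dd xi p e_x * (dd mu p e_t + b_of p * ux_of p * dd mu p e_u) -
    (dd mu p e_x + ux_of p * dd mu p e_u) * (dd xi p e_t + be p * (dd xi p e_x)\<^sup>2) -
    dd xi p e_x * \<epsilon> * (dd (\<lambda>q. dd mu q e_x) p e_x + ux_of p * (dd (\<lambda>q. dd mu q e_x) p e_u +
      dd (\<lambda>q. dd mu q e_u) p e_x) + (ux_of p)\<^sup>2 * dd (\<lambda>q. dd mu q e_u) p e_u) = 0"
proof -
  have M: "vx q * dd xi q e_x = dd mu q e_x + ux_of q * dd mu q e_u" if "q \<in> D" for q
    using contact_mu(2)[OF that] ta_x[OF that] ta_u[OF that] xi_u[OF that] by simp
  note h = smooth_on_has_derivative[OF _ p]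
  have "dd vx p (D_x p) = vxx p * dd xi p e_x"
    using contact(3)[OF p, of "D_x p"] dd_base_comps[OF p, of "D_x p"] ta_x[OF p] ta_u[OF p] xi_u[OF p]
    by (simp add: cartan_iff)
  then have 1: "vxx p * (dd xi p e_x)\<^sup>2 = dd (\<lambda>q. dd mu q e_x) p (D_x p) +
      (ux_of p * dd (\<lambda>q. dd mu q e_u) p (D_x p) + uxx_of p * dd mu p e_u)"
    using has_derivative_eq_on_open[OF openD p M has_derivative_mult[OF h[OF smooth_comps(5)] h[OF smooth_dd_comps(2)]]
        has_derivative_add[OF h[OF smooth_dd_comps(3)] has_derivative_mult[OF has_derivative_ut_ux(2) h[OF smooth_dd_comps(3)]]],
        of "D_x p"] dd_xi_x[OF p, of "D_x p"]
    by (simp add: power2_eq_square)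
  have 2: "dd mu p e_t + ut_of p * dd mu p e_u = vt p * (dd xi p e_x)\<^sup>2 + vx p * dd xi p e_t"
    using contact_mu(1)[OF p] ta_x[OF p] ta_u[OF p] xi_u[OF p] xi_x_square[OF p] by simp
  show ?thesis
    using 1 2 M[OF p] transformed_equation(1)[OF p eq] eq
    unfolding dd_dd_mu[OF p, of _ "D_x p"] on_equation_def fst_conv snd_conv by algebra
qed

lemma split_determining_equation:
  assumes p: "p \<in> D"
  shows "dd (\<lambda>q. dd mu q e_u) p e_u = 0"
    and "dd mu p e_u * (b_of p * dd xi p e_x - dd xi p e_t - be p * (dd xi p e_x)\<^sup>2) =
      dd xi p e_x * \<epsilon> * (dd (\<lambda>q. dd mu q e_x) p e_u + dd (\<lambda>q. dd mu q e_u) p e_x)"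
    and "dd xi p e_x * dd mu p e_t - dd mu p e_x * (dd xi p e_t + be p * (dd xi p e_x)\<^sup>2) =
      dd xi p e_x * \<epsilon> * dd (\<lambda>q. dd mu q e_x) p e_x"
proof -
  obtain q where q: "q \<in> D" "on_equation \<epsilon> q" "base_of q = base_of p" "b_of q = b_of p" by (rule obtain_on_equation[OF p])
  let ?v = "e_ux + b_of q *\<^sub>R e_ut"
  obtain r where r: "r > 0" "\<And>s. \<bar>s\<bar> < r \<Longrightarrow> q + s *\<^sub>R ?v \<in> D"
    using open_line[OF openD q(1), of ?v] by blast
  \<comment> \<open>\<open>h0\<close>, \<open>h1\<close>, \<open>h2\<close> are the coefficients of
    the determining equation as a polynomial in \<open>u\<^sub>x\<close> over fixed
    \<open>(t, x, u, B)\<close>.\<close>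
  define h0 where "h0 = dd xi p e_x * dd mu p e_t - dd mu p e_x * (dd xi p e_t + be p * (dd xi p e_x)\<^sup>2)
    - dd xi p e_x * \<epsilon> * dd (\<lambda>q. dd mu q e_x) p e_x"
  define h1 where "h1 = dd mu p e_u * (b_of p * dd xi p e_x - dd xi p e_t - be p * (dd xi p e_x)\<^sup>2)
    - dd xi p e_x * \<epsilon> * (dd (\<lambda>q. dd mu q e_x) p e_u + dd (\<lambda>q. dd mu q e_u) p e_x)"
  define h2 where "h2 = - dd xi p e_x * \<epsilon> * dd (\<lambda>q. dd mu q e_u) p e_u"
  \<comment> \<open>The same polynomial recentred at \<open>ux_of q\<close>, because only values of
    \<open>u\<^sub>x\<close> near this one are available.\<close>
  have *: "(h0 + h1 * ux_of q + h2 * (ux_of q)\<^sup>2) + (h1 + 2 * h2 * ux_of q) * s + h2 * s\<^sup>2 = 0" if s: "\<bar>s\<bar> < r" for s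
  proof -
    let ?q = "q + s *\<^sub>R ?v"
    have on: "on_equation \<epsilon> ?q"
      using q(2) by (simp add: on_equation_def algebra_simps)
    have b: "base_of ?q = base_of p" "b_of ?q = b_of p" "ux_of ?q = ux_of q + s"
      using q(3,4) by (simp_all add: prod_eq_iff)
    have be: "be ?q = be p"
      using transformed_equation(2)[OF r(2)[OF s] on p] b by simp
    have dd: "dd (\<lambda>q. dd mu q w) ?q v = dd (\<lambda>q. dd mu q w) p v" for v w
      by (rule factors_onD[OF factors_on_dd[OF openD smooth_dd_comps(3) linear_base
            factors_on_dd[OF openD smooth_comps(3) linear_base base_factor(3)]] r(2)[OF s] p b(1)])
    show ?thesis
      using determining_equation[OF r(2)[OF s] on]
      unfolding dd be b dd_comps_base_cong[OF r(2)[OF s] p b(1)] h0_def h1_def h2_def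
      by (simp add: algebra_simps power2_eq_square)
  qed
  note z = quadratic_eq_0_near_0[OF r(1) *]
  from z have "h2 = 0" "h1 = 0" "h0 = 0" by auto
  then show "dd (\<lambda>q. dd mu q e_u) p e_u = 0"
    "dd mu p e_u * (b_of p * dd xi p e_x - dd xi p e_t - be p * (dd xi p e_x)\<^sup>2) =
      dd xi p e_x * \<epsilon> * (dd (\<lambda>q. dd mu q e_x) p e_u + dd (\<lambda>q. dd mu q e_u) p e_x)"
    "dd xi p e_x * dd mu p e_t - dd mu p e_x * (dd xi p e_t + be p * (dd xi p e_x)\<^sup>2) =
      dd xi p e_x * \<epsilon> * dd (\<lambda>q. dd mu q e_x) p e_x"
    using xi_x_nz[OF p] eps by (auto simp: h0_def h1_def h2_def)
qed

lemma mu_x: "p \<in> D \<Longrightarrow> dd mu p e_x = 0"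
proof -
  assume p: "p \<in> D"
  let ?e = "((0, (0, 0), 0), 1) :: ext"
  obtain r where r: "r > 0" "\<And>s. \<bar>s\<bar> < r \<Longrightarrow> p + s *\<^sub>R ?e \<in> D"
    using open_line[OF openD p, of ?e] by blast
  \<comment> \<open>What remains when \<open>be\<close> is eliminated between the coefficients of
    \<open>u\<^sub>x\<close> and of \<open>1\<close>: \<open>a\<close> is built from derivatives of
    \<open>mu\<close>, hence does not see B, whereas the other side of the resulting relation is
    proportional to B.\<close>
  define a where "a q = dd mu q e_u * dd mu q e_t - dd mu q e_u * \<epsilon> * dd (\<lambda>q. dd mu q e_x) q e_x
    + \<epsilon> * (dd (\<lambda>q. dd mu q e_x) q e_u + dd (\<lambda>q. dd mu q e_u) q e_x) * dd mu q e_x" for q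
  have a: "a q = b_of q * dd mu q e_u * dd mu q e_x" if q: "q \<in> D" for q
  proof -
    have "dd xi q e_x * a q = dd xi q e_x * (b_of q * dd mu q e_u * dd mu q e_x)"
      using split_determining_equation(2,3)[OF q] unfolding a_def by algebra
    then show ?thesis using xi_x_nz[OF q] by simp
  qed
  let ?q = "p + (r / 2) *\<^sub>R ?e"
  have q: "?q \<in> D" using r(1) by (intro r(2)) simp
  have b: "base_of ?q = base_of p" by (simp add: prod_eq_iff zero_prod_def)
  have "dd (\<lambda>q. dd mu q w) ?q v = dd (\<lambda>q. dd mu q w) p v" for v w
    by (rule factors_onD[OF factors_on_dd[OF openD smooth_dd_comps(3) linear_base
          factors_on_dd[OF openD smooth_comps(3) linear_base base_factor(3)]] q p b(1)])
  then have "a ?q = a p" unfolding a_def dd_comps_base_cong[OF q p b] by simp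
  then have "(r / 2) * (dd mu p e_u * dd mu p e_x) = 0"
    using a[OF p] a[OF q] unfolding dd_comps_base_cong[OF q p b] by (simp add: algebra_simps)
  then show ?thesis using r(1) mu_u_nz[OF p] by simp
qed

lemma mu_xv: "p \<in> D \<Longrightarrow> dd (\<lambda>q. dd mu q e_x) p v = 0"
  using has_derivative_eq_on_open[OF openD _ mu_x smooth_on_has_derivative[OF smooth_dd_comps(3)] has_derivative_const]
  by simp

lemma mu_t: "p \<in> D \<Longrightarrow> dd mu p e_t = 0"
  using split_determining_equation(3)[of p] mu_x[of p] mu_xv[of p] xi_x_nz[of p] by simp

lemma mu_factor: "factors_on D u_of mu"
proof (rule factors_onI_dd[OF convexD smooth_comps(3) linear_u])
  show "dd mu p v = 0" if "p \<in> D" "u_of v = 0" for p v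
    using dd_base_comps(3)[of p v] mu_x[of p] mu_t[of p] that by simp
qed

text \<open>Since \<open>mu\<close> depends on u only, so does its u-derivative, and
  \<open>split_determining_equation\<close> disposes of the remaining direction.\<close>

lemma dd_mu_u: "p \<in> D \<Longrightarrow> dd (\<lambda>q. dd mu q e_u) p v = 0"
proof -
  assume p: "p \<in> D"
  have "dd (\<lambda>q. dd mu q e_u) p w = 0" if "u_of w = 0" for w
    by (rule factors_on_dd_eq_0[OF openD smooth_dd_comps(3) linear_u
          factors_on_dd[OF openD smooth_comps(3) linear_u mu_factor] p that])
  then show ?thesis using dd_dd_mu[OF p, of e_u v] split_determining_equation(1)[OF p] by simp
qed

lemma be_eq:
  assumes p: "p \<in> D"
  shows "be p = b_of p / dd xi p e_x - dd xi p e_t / (dd xi p e_x)\<^sup>2"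
proof -
  have "b_of p * dd xi p e_x - dd xi p e_t - be p * (dd xi p e_x)\<^sup>2 = 0"
    using split_determining_equation(2)[OF p] mu_xv[OF p] dd_mu_u[OF p] mu_u_nz[OF p] by simp
  then show ?thesis using xi_x_nz[OF p] by (simp add: field_simps power2_eq_square)
qed

end

subsection \<open>Prolongation of the admitted transformations\<close>

text \<open>Both inclusions use this setting: one to recognise a given element as a prolongation,
  the other to verify the defining properties. The interval \<open>I\<close> stands for
  \<open>time_range D\<close>.\<close>

locale kolmogorov_transformation =
  fixes I :: "real set" and T X1 X0 :: "real \<Rightarrow> real" and c1 c2 :: real
  assumes openI: "open I" and convexI: "convex I"
    and smooth_T: "smooth_on I T" and smooth_X1: "smooth_on I X1" and smooth_X0: "smooth_on I X0"
    and X1_nz: "t \<in> I \<Longrightarrow> X1 t \<noteq> 0" and deriv_T: "t \<in> I \<Longrightarrow> deriv T t = (X1 t)\<^sup>2"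
    and c1_nz: "c1 \<noteq> 0"
begin

abbreviation phi :: "base \<Rightarrow> base" where
  "phi \<equiv> \<lambda>(t, x, u). (T t, X1 t * x + X0 t, c1 * u + c2)"

text \<open>\<open>m\<close> is the \<open>t\<close>-derivative of \<open>X1 t * x + X0 t\<close>; \<open>P\<close>, \<open>Q\<close>, \<open>Vtt\<close>, \<open>Vtx\<close>, \<open>Vxx\<close> are the prolonged
  \<open>u\<^sub>t\<close>, \<open>u\<^sub>x\<close>, \<open>u\<^sub>t\<^sub>t\<close>, \<open>u\<^sub>t\<^sub>x\<close>, \<open>u\<^sub>x\<^sub>x\<close>; and \<open>P_t\<close>, \<open>P_x\<close>, \<open>P_ut\<close>, \<open>P_ux\<close> are the partial derivatives of \<open>P\<close>.\<close>

definition "m t x = deriv X1 t * x + deriv X0 t"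
definition "m' t x = deriv (deriv X1) t * x + deriv (deriv X0) t"
definition "Q t ux = c1 * ux / X1 t"
definition "P t x ut ux = c1 * ut / (X1 t)\<^sup>2 - c1 * ux * m t x / (X1 t) ^ 3"
definition "P_t t x ut ux = - 2 * c1 * ut * deriv X1 t / (X1 t) ^ 3 - c1 * ux * m' t x / (X1 t) ^ 3
  + 3 * c1 * ux * m t x * deriv X1 t / (X1 t) ^ 4"
definition "P_x t ux = - c1 * ux * deriv X1 t / (X1 t) ^ 3"
definition "P_ut t = c1 / (X1 t)\<^sup>2"
definition "P_ux t x = - c1 * m t x / (X1 t) ^ 3"
definition "Vtx t x ux utx uxx = (P_x t ux + utx * P_ut t + uxx * P_ux t x) / X1 t"
definition "Vtt t x ut ux utt utx uxx =
  (P_t t x ut ux + utt * P_ut t + utx * P_ux t x - m t x * Vtx t x ux utx uxx) / (X1 t)\<^sup>2"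
definition "Vxx t uxx = c1 * uxx / (X1 t)\<^sup>2"

lemma has_derivative_params:
  assumes f: "(f has_derivative f') (at p)" and I: "f p \<in> I"
  shows "((\<lambda>p. T (f p)) has_derivative (\<lambda>h. (X1 (f p))\<^sup>2 * f' h)) (at p)"
    "((\<lambda>p. X1 (f p)) has_derivative (\<lambda>h. deriv X1 (f p) * f' h)) (at p)"
    "((\<lambda>p. X0 (f p)) has_derivative (\<lambda>h. deriv X0 (f p) * f' h)) (at p)"
    "((\<lambda>p. deriv X1 (f p)) has_derivative (\<lambda>h. deriv (deriv X1) (f p) * f' h)) (at p)"
    "((\<lambda>p. deriv X0 (f p)) has_derivative (\<lambda>h. deriv (deriv X0) (f p) * f' h)) (at p)"
  using DERIV_compose_FDERIV[OF smooth_on_has_real_derivative[OF smooth_T I] f]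
    DERIV_compose_FDERIV[OF smooth_on_has_real_derivative[OF smooth_X1 I] f]
    DERIV_compose_FDERIV[OF smooth_on_has_real_derivative[OF smooth_X0 I] f]
    DERIV_compose_FDERIV[OF smooth_on_has_real_derivative[OF smooth_on_deriv[OF openI smooth_X1] I] f]
    DERIV_compose_FDERIV[OF smooth_on_has_real_derivative[OF smooth_on_deriv[OF openI smooth_X0] I] f]
  by (simp_all add: deriv_T[OF I] mult.commute)

context
  fixes p :: "'a::real_normed_vector" and ft fx fut fux ft' fx' fut' fux' :: "'a \<Rightarrow> real"
  assumes d: "(ft has_derivative ft') (at p)" "(fx has_derivative fx') (at p)"
      "(fut has_derivative fut') (at p)" "(fux has_derivative fux') (at p)"
    and I: "ft p \<in> I"
begin

text \<open>The coordinates enter as arbitrary differentiable functions, so one formula serves on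
  the base, on \<open>jet1\<close> and on \<open>ext\<close>.\<close>

lemma has_derivative_X:
  "((\<lambda>p. X1 (ft p) * fx p + X0 (ft p)) has_derivative (\<lambda>h. X1 (ft p) * fx' h + m (ft p) (fx p) * ft' h)) (at p)"
  by (rule has_derivative_eq_rhs, (rule derivative_intros has_derivative_params d I)+)
     (auto simp: fun_eq_iff m_def algebra_simps)

lemma has_derivative_m:
  "((\<lambda>p. m (ft p) (fx p)) has_derivative (\<lambda>h. deriv X1 (ft p) * fx' h + m' (ft p) (fx p) * ft' h)) (at p)"
  unfolding m_def
  by (rule has_derivative_eq_rhs, (rule derivative_intros has_derivative_params d I)+)
     (auto simp: fun_eq_iff m'_def algebra_simps)

lemma has_derivative_Q:
  "((\<lambda>p. Q (ft p) (fux p)) has_derivative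
     (\<lambda>h. c1 / X1 (ft p) * fux' h - c1 * fux p * deriv X1 (ft p) / (X1 (ft p))\<^sup>2 * ft' h)) (at p)"
  unfolding Q_def
  by (rule has_derivative_eq_rhs, (rule derivative_intros has_derivative_params d I X1_nz)+)
     (use X1_nz[OF I] in \<open>auto simp: fun_eq_iff field_simps power2_eq_square\<close>)

lemma has_derivative_P:
  "((\<lambda>p. P (ft p) (fx p) (fut p) (fux p)) has_derivative
     (\<lambda>h. P_t (ft p) (fx p) (fut p) (fux p) * ft' h + P_x (ft p) (fux p) * fx' h +
        P_ut (ft p) * fut' h + P_ux (ft p) (fx p) * fux' h)) (at p)"
proof -
  have "X1 (ft p) ^ 2 \<noteq> 0" "X1 (ft p) ^ 3 \<noteq> 0" using X1_nz[OF I] by auto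
  then show ?thesis
    unfolding P_def
    by - (rule has_derivative_eq_rhs, (rule derivative_intros has_derivative_params has_derivative_m d I | assumption)+,
      use X1_nz[OF I] in \<open>auto simp: fun_eq_iff P_t_def P_x_def P_ut_def P_ux_def field_simps
        power2_eq_square power3_eq_cube power4_eq_xxxx\<close>)
qed

end

lemma has_derivative_phi:
  assumes t: "fst z \<in> I"
  shows "(phi has_derivative (\<lambda>h. ((X1 (fst z))\<^sup>2 * fst h,
    X1 (fst z) * fst (snd h) + m (fst z) (fst (snd z)) * fst h, c1 * snd (snd h)))) (at z)"
proof -
  have d: "(fst has_derivative fst) (at z)" "((\<lambda>z. fst (snd z)) has_derivative (\<lambda>h. fst (snd h))) (at z)"
    "((\<lambda>z. snd (snd z)) has_derivative (\<lambda>h. snd (snd h))) (at z)"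
    by (intro bounded_linear_imp_has_derivative bounded_linear_intros)+
  have "((\<lambda>z. (T (fst z), X1 (fst z) * fst (snd z) + X0 (fst z), c1 * snd (snd z) + c2)) has_derivative
    (\<lambda>h. ((X1 (fst z))\<^sup>2 * fst h,
      X1 (fst z) * fst (snd h) + m (fst z) (fst (snd z)) * fst h, c1 * snd (snd h)))) (at z)"
    by (intro has_derivative_Pair has_derivative_params(1)[OF d(1) t] has_derivative_X[OF d(1,2) d(1,1) t])
       (auto intro!: derivative_eq_intros d(3))
  then show ?thesis by (simp add: case_prod_unfold)
qed

lemma prolong1_eq:
  assumes t: "t \<in> I"
  shows "prolong1 phi ((t, x, u), (ut, ux)) = (phi (t, x, u), (P t x ut ux, Q t ux))"
proof -
  have d: "dd phi (t, x, u) v =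
      ((X1 t)\<^sup>2 * fst v, X1 t * fst (snd v) + m t x * fst v, c1 * snd (snd v))" for v
    by (rule fun_cong[OF frechet_derivative_at[symmetric],
          OF has_derivative_phi[of "(t, x, u)", unfolded fst_conv snd_conv, OF t]])
  show ?thesis
    using X1_nz[OF t]
    by (simp add: prolong1_def total_quot_def d)
       (simp add: P_def Q_def field_simps power2_eq_square power3_eq_cube)
qed

lemma has_derivative_prolong1:
  assumes t: "t \<in> I"
  shows "(prolong1 phi has_derivative (\<lambda>((dt, dx, du), (dut, dux)).
     (((X1 t)\<^sup>2 * dt, X1 t * dx + m t x * dt, c1 * du),
      (P_t t x ut ux * dt + P_x t ux * dx + P_ut t * dut + P_ux t x * dux,
       c1 / X1 t * dux - c1 * ux * deriv X1 t / (X1 t)\<^sup>2 * dt)))) (at ((t, x, u), (ut, ux)))"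
proof -
  let ?z = "((t, x, u), (ut, ux))" and ?S = "{z :: jet1. fst (fst z) \<in> I}"
  have d: "((\<lambda>z. fst (fst z)) has_derivative (\<lambda>h. fst (fst h))) (at ?z)"
    "((\<lambda>z. fst (snd (fst z))) has_derivative (\<lambda>h. fst (snd (fst h)))) (at ?z)"
    "((\<lambda>z. fst (snd z)) has_derivative (\<lambda>h. fst (snd h))) (at ?z)"
    "((\<lambda>z. snd (snd z)) has_derivative (\<lambda>h. snd (snd h))) (at ?z)"
    "(fst has_derivative fst) (at ?z)"
    by (intro bounded_linear_imp_has_derivative bounded_linear_intros)+
  have tI: "fst (fst ?z) \<in> I" using t by simp
  have "((\<lambda>z. (phi (fst z), (P (fst (fst z)) (fst (snd (fst z))) (fst (snd z)) (snd (snd z)),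
      Q (fst (fst z)) (snd (snd z))))) has_derivative (\<lambda>h.
     (((X1 t)\<^sup>2 * fst (fst h), X1 t * fst (snd (fst h)) + m t x * fst (fst h), c1 * snd (snd (fst h))),
      (P_t t x ut ux * fst (fst h) + P_x t ux * fst (snd (fst h)) + P_ut t * fst (snd h) + P_ux t x * snd (snd h),
       c1 / X1 t * snd (snd h) - c1 * ux * deriv X1 t / (X1 t)\<^sup>2 * fst (fst h))))) (at ?z)"
    using has_derivative_compose[OF d(5) has_derivative_phi] has_derivative_P[OF d(1-4) tI]
      has_derivative_Q[OF d(1-4) tI] t
    by (intro has_derivative_Pair) simp_all
  moreover have "open ?S"
    using open_vimage[OF openI, of "\<lambda>z :: jet1. fst (fst z)"] by (simp add: vimage_def continuous_intros)
  moreover have "(phi (fst z), (P (fst (fst z)) (fst (snd (fst z))) (fst (snd z)) (snd (snd z)),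
      Q (fst (fst z)) (snd (snd z)))) = prolong1 phi z" if "z \<in> ?S" for z
    using prolong1_eq[of "fst (fst z)" "fst (snd (fst z))" "snd (snd (fst z))" "fst (snd z)" "snd (snd z)"] that
    by simp
  ultimately show ?thesis
    using has_derivative_transform_within_open[of _ _ ?z UNIV ?S "prolong1 phi"] t
    by (simp add: case_prod_unfold)
qed

text \<open>The new time has zero total x-derivative, so the determinant in
  \<open>total_quot\<close> is \<open>(X1 t)^3\<close> and the quotients become explicit. The mixed
  derivative is taken from the total derivatives of \<open>P\<close>, as in
  \<open>prolong2\<close>.\<close>

lemma prolong2_eq:
  assumes t: "t \<in> I"
  shows "prolong2 phi ((t, x, u), (ut, ux), (utt, utx, uxx)) =
    (phi (t, x, u), (P t x ut ux, Q t ux),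
      (Vtt t x ut ux utt utx uxx, Vtx t x ux utx uxx, Vxx t uxx))"
proof -
  have d: "dd (prolong1 phi) ((t, x, u), (ut, ux)) ((dt, dx, du), (dut, dux)) =
     (((X1 t)\<^sup>2 * dt, X1 t * dx + m t x * dt, c1 * du),
      (P_t t x ut ux * dt + P_x t ux * dx + P_ut t * dut + P_ux t x * dux,
       c1 / X1 t * dux - c1 * ux * deriv X1 t / (X1 t)\<^sup>2 * dt))" for dt dx du dut dux
    unfolding frechet_derivative_at[OF has_derivative_prolong1[OF t], symmetric] by simp
  show ?thesis
    using X1_nz[OF t]
    by (simp add: prolong2_def Let_def total_quot_def d prolong1_eq[OF t])
       (simp add: Vtt_def Vtx_def Vxx_def field_simps power2_eq_square)
qed

end

subsection \<open>Explicit form of the elements of the equivalence group\<close>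

lemma open_time_range:
  fixes D :: "ext set"
  assumes "open D"
  shows "open (time_range D)"
proof -
  have "surj t_of"
    by (rule surjI[of _ "\<lambda>t. (((t, 0, 0), (0, 0), (0, 0, 0)), 0)"]) simp
  moreover have "linear t_of" by (intro bounded_linear.linear bounded_linear_intros)
  ultimately show ?thesis
    using open_surjective_linear_image[OF assms] by (simp add: time_range_eq)
qed

lemma convex_time_range:
  fixes D :: "ext set"
  assumes "convex D"
  shows "convex (time_range D)"
  unfolding time_range_eq
  by (intro convex_linear_image assms bounded_linear.linear bounded_linear_intros)

lemma has_derivative_coordinates:
  fixes p :: ext
  shows "(t_of has_derivative t_of) (at p)" "(x_of has_derivative x_of) (at p)"
    "(u_of has_derivative u_of) (at p)" "(ut_of has_derivative ut_of) (at p)"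
    "(ux_of has_derivative ux_of) (at p)"
  by (intro bounded_linear_imp_has_derivative bounded_linear_intros)+

lemma smooth_on_coordinates:
  fixes D :: "ext set"
  assumes "open D"
  shows "smooth_on D t_of" "smooth_on D x_of" "smooth_on D u_of" "smooth_on D ut_of" "smooth_on D ux_of"
    "smooth_on D utt_of" "smooth_on D utx_of" "smooth_on D uxx_of" "smooth_on D b_of"
  by (intro smooth_on_linear bounded_linear_intros assms)+

context kolmogorov_equivalence
begin

text \<open>Only the base components need integration. The contact conditions then determine all
  derivative components algebraically, by the formulas of the prolongation.\<close>

lemma explicit_form:
  assumes ne: "D \<noteq> {}"
  obtains T X1 X0 c1 c2 where "kolmogorov_transformation (time_range D) T X1 X0 c1"
    and "\<And>p. p \<in> D \<Longrightarrow> \<Phi> p = (prolong2 (\<lambda>(t, x, u). (T t, X1 t * x + X0 t, c1 * u + c2)) (fst p),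
      b_of p / X1 (t_of p) - (deriv X1 (t_of p) * x_of p + deriv X0 (t_of p)) / (X1 (t_of p))\<^sup>2)"
proof -
  note ex = factors_on_real_smooth[OF openD _ linear_t, of _ e_t]
  obtain T where T: "smooth_on (t_of ` D) T" "\<And>p. p \<in> D \<Longrightarrow> ta p = T (t_of p)"
    using ex[OF smooth_comps(1) _ ta_factor] by auto
  obtain X1 where X1: "smooth_on (t_of ` D) X1" "\<And>p. p \<in> D \<Longrightarrow> dd xi p e_x = X1 (t_of p)"
    using ex[OF smooth_dd_comps(2) _ xi_x_factor] by auto
  \<comment> \<open>The candidate for \<open>X0 t\<close>: what is left of \<open>xi\<close> after
    removing its part linear in x.\<close>
  let ?G = "\<lambda>p. xi p - dd xi p e_x * x_of p"
  have G: "smooth_on D ?G"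
    by (intro smooth_intros smooth_comps smooth_dd_comps openD smooth_on_coordinates)
  have "factors_on D t_of ?G"
  proof (rule factors_onI_dd[OF convexD G linear_t])
    fix p v assume p: "p \<in> D" and v: "t_of v = 0"
    have "dd ?G p v = dd xi p v - (dd xi p e_x * x_of v + dd (\<lambda>q. dd xi q e_x) p v * x_of p)"
      by (rule fun_cong[OF frechet_derivative_at[symmetric]],
          intro has_derivative_diff has_derivative_mult has_derivative_coordinates
            smooth_on_has_derivative[OF _ p] smooth_comps smooth_dd_comps)
    then show "dd ?G p v = 0"
      using dd_base_comps(2)[OF p, of v] dd_xi_x[OF p v] xi_u[OF p] v by simp
  qed
  from ex[OF G _ this] obtain X0 where X0: "smooth_on (t_of ` D) X0"
    and "\<And>p. p \<in> D \<Longrightarrow> ?G p = X0 (t_of p)"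
    by auto
  then have xi: "xi p = X1 (t_of p) * x_of p + X0 (t_of p)" if "p \<in> D" for p
    using that X1(2)[OF that] by (simp add: algebra_simps)

  \<comment> \<open>A function that factors through the zero map is constant.\<close>
  have lin0: "linear (\<lambda>_ :: ext. 0 :: real)" by (rule bounded_linear.linear[OF bounded_linear_zero])
  obtain p0 where p0: "p0 \<in> D" using ne by blast
  define c1 where "c1 = dd mu p0 e_u"
  have "factors_on D (\<lambda>_. 0 :: real) (\<lambda>p. dd mu p e_u)"
    by (rule factors_onI_dd[OF convexD smooth_dd_comps(3) lin0 dd_mu_u])
  then have mu_u: "dd mu p e_u = c1" if "p \<in> D" for p
    unfolding c1_def by (rule factors_onD[OF _ that p0 refl])
  have c1: "c1 \<noteq> 0" unfolding c1_def by (rule mu_u_nz[OF p0])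
  let ?H = "\<lambda>p. mu p - c1 * u_of p"
  define c2 where "c2 = ?H p0"
  have H: "smooth_on D ?H"
    by (intro smooth_intros smooth_comps openD smooth_on_coordinates)
  have "factors_on D (\<lambda>_. 0 :: real) ?H"
  proof (rule factors_onI_dd[OF convexD H lin0])
    fix p v assume p: "p \<in> D"
    have "dd ?H p v = dd mu p v - (c1 * u_of v)"
      by (rule fun_cong[OF frechet_derivative_at[symmetric]],
          intro has_derivative_diff has_derivative_mult_right has_derivative_coordinates
            smooth_on_has_derivative[OF _ p] smooth_comps)
    then show "dd ?H p v = 0"
      using dd_base_comps(3)[OF p, of v] mu_u[OF p] mu_x[OF p] mu_t[OF p] by simp
  qed
  then have "?H p = c2" if "p \<in> D" for p
    unfolding c2_def by (rule factors_onD[OF _ that p0 refl])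
  then have mu: "mu p = c1 * u_of p + c2" if "p \<in> D" for p
    using that by (simp add: algebra_simps)

  have ta_t: "dd ta p e_t = deriv T (t_of p)" if p: "p \<in> D" for p
  proof -
    have "(T has_real_derivative deriv T (t_of p)) (at (t_of p))"
      by (rule smooth_on_has_real_derivative[OF T(1)]) (use p in blast)
    from has_derivative_eq_on_open[OF openD p T(2) smooth_on_has_derivative[OF smooth_comps(1) p]
        DERIV_compose_FDERIV[OF this has_derivative_coordinates(1)], of e_t]
    show ?thesis by simp
  qed
  interpret tr: kolmogorov_transformation "time_range D" T X1 X0 c1 c2
  proof
    show "X1 t \<noteq> 0" "deriv T t = (X1 t)\<^sup>2" if "t \<in> time_range D" for t
    proof -
      from that obtain p where p: "p \<in> D" "t = t_of p" by (auto simp: time_range_eq)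
      show "X1 t \<noteq> 0" "deriv T t = (X1 t)\<^sup>2"
        using xi_x_nz[OF p(1)] xi_x_square[OF p(1)] ta_t[OF p(1)] X1(2)[OF p(1)] p(2) by simp_all
    qed
  qed (use T X1 X0 c1 openD convexD open_time_range convex_time_range in \<open>simp_all add: time_range_eq\<close>)

  show thesis
  proof (rule that)
    show "kolmogorov_transformation (time_range D) T X1 X0 c1" by (rule tr.kolmogorov_transformation_axioms)
    fix p assume p: "p \<in> D"
    have tI: "t_of q \<in> time_range D" if "q \<in> D" for q using that by (simp add: time_range_eq)
    note nz = tr.X1_nz[OF tI[OF p]]
    note hd = has_derivative_coordinates
    have dta: "dd ta q v = (X1 (t_of q))\<^sup>2 * t_of v" if q: "q \<in> D" for q v
      using dd_base_comps(1)[OF q, of v] ta_x[OF q] ta_u[OF q] ta_t[OF q] tr.deriv_T[OF tI[OF q]] by simp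
    have dxi: "dd xi q v = X1 (t_of q) * x_of v + tr.m (t_of q) (x_of q) * t_of v" if q: "q \<in> D" for q v
      by (rule has_derivative_eq_on_open[OF openD q xi smooth_on_has_derivative[OF smooth_comps(2) q]
            tr.has_derivative_X[OF hd(1,2,1,1) tI[OF q]]])
    \<comment> \<open>Along \<open>D_x\<close> the derivative of \<open>ta\<close> vanishes, so the
      \<open>D_x\<close>-conditions contain a single unknown and come before the
      \<open>D_t\<close>-conditions: \<open>vx\<close> before \<open>vt\<close>, and
      \<open>vtx\<close> before \<open>vtt\<close>.\<close>
    have vx: "vx q = tr.Q (t_of q) (ux_of q)" if q: "q \<in> D" for q
      using contact_mu(2)[OF q] mu_u[OF q] mu_x[OF q] tr.X1_nz[OF tI[OF q]] unfolding dta[OF q] dxi[OF q]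
      by (simp add: tr.Q_def field_simps)
    have vt: "vt q = tr.P (t_of q) (x_of q) (ut_of q) (ux_of q)" if q: "q \<in> D" for q
      using contact_mu(1)[OF q] mu_u[OF q] mu_t[OF q] vx[OF q] tr.X1_nz[OF tI[OF q]] unfolding dta[OF q] dxi[OF q]
      by (simp add: tr.P_def tr.Q_def field_simps power2_eq_square power3_eq_cube)
    have dvx: "dd vx p v = c1 / X1 (t_of p) * ux_of v
        - c1 * ux_of p * deriv X1 (t_of p) / (X1 (t_of p))\<^sup>2 * t_of v" for v
      by (rule has_derivative_eq_on_open[OF openD p vx smooth_on_has_derivative[OF smooth_comps(5) p]
            tr.has_derivative_Q[OF hd(1,1,1,5) tI[OF p]]])
    have dvt: "dd vt p v = tr.P_t (t_of p) (x_of p) (ut_of p) (ux_of p) * t_of v +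
        tr.P_x (t_of p) (ux_of p) * x_of v + tr.P_ut (t_of p) * ut_of v + tr.P_ux (t_of p) (x_of p) * ux_of v" for v
      by (rule has_derivative_eq_on_open[OF openD p vt smooth_on_has_derivative[OF smooth_comps(4) p]
            tr.has_derivative_P[OF hd(1,2,4,5) tI[OF p]]])
    have cart: "fst (D_x p) \<in> cartan (fst p)" "fst (D_t p) \<in> cartan (fst p)"
      by (simp_all add: cartan_iff)
    have vxx: "vxx p = tr.Vxx (t_of p) (uxx_of p)"
      using contact(3)[OF p cart(1)] nz unfolding dvx dta[OF p] dxi[OF p]
      by (simp add: tr.Vxx_def field_simps power2_eq_square)
    have vtx: "vtx p = tr.Vtx (t_of p) (x_of p) (ux_of p) (utx_of p) (uxx_of p)"
      using contact(2)[OF p cart(1)] nz unfolding dvt dta[OF p] dxi[OF p]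
      by (simp add: tr.Vtx_def field_simps)
    have vtt: "vtt p = tr.Vtt (t_of p) (x_of p) (ut_of p) (ux_of p) (utt_of p) (utx_of p) (uxx_of p)"
      using contact(2)[OF p cart(2)] vtx nz unfolding dvt dta[OF p] dxi[OF p]
      by (simp add: tr.Vtt_def field_simps)
    have "be p = b_of p / X1 (t_of p) -
        (deriv X1 (t_of p) * x_of p + deriv X0 (t_of p)) / (X1 (t_of p))\<^sup>2"
      using be_eq[OF p] dxi[OF p] by (simp add: tr.m_def)
    moreover have "\<Phi> p = (((ta p, xi p, mu p), (vt p, vx p), (vtt p, vtx p, vxx p)), be p)"
      by (simp add: comp_defs)
    moreover have "prolong2 (\<lambda>(t, x, u). (T t, X1 t * x + X0 t, c1 * u + c2)) (fst p) =
        ((ta p, xi p, mu p), (vt p, vx p), (vtt p, vtx p, vxx p))"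
      using tr.prolong2_eq[OF tI[OF p], of "x_of p" "u_of p" "ut_of p" "ux_of p" "utt_of p" "utx_of p" "uxx_of p"]
      by (simp add: case_prod_unfold T(2)[OF p] xi[OF p] mu[OF p] vt[OF p] vx[OF p] vxx vtx vtt)
    ultimately show "\<Phi> p = (prolong2 (\<lambda>(t, x, u). (T t, X1 t * x + X0 t, c1 * u + c2)) (fst p),
      b_of p / X1 (t_of p) - (deriv X1 (t_of p) * x_of p + deriv X0 (t_of p)) / (X1 (t_of p))\<^sup>2)"
      by simp
  qed
qed

end

subsection \<open>Transformations of the explicit form belong to the equivalence group\<close>

context kolmogorov_transformation
begin

lemma smooth_on_params:
  assumes "open S" "smooth_on S f" "\<And>p. p \<in> S \<Longrightarrow> f p \<in> I"
  shows "smooth_on S (\<lambda>p. T (f p))" "smooth_on S (\<lambda>p. X1 (f p))" "smooth_on S (\<lambda>p. X0 (f p))"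
    "smooth_on S (\<lambda>p. deriv X1 (f p))" "smooth_on S (\<lambda>p. deriv X0 (f p))"
    "smooth_on S (\<lambda>p. deriv (deriv X1) (f p))" "smooth_on S (\<lambda>p. deriv (deriv X0) (f p))"
proof -
  note smooth_deriv = smooth_on_deriv[OF openI]
  note compose = smooth_on_compose[OF _ openI assms]
  show "smooth_on S (\<lambda>p. T (f p))" by (rule compose[OF smooth_T])
  show "smooth_on S (\<lambda>p. X1 (f p))" by (rule compose[OF smooth_X1])
  show "smooth_on S (\<lambda>p. X0 (f p))" by (rule compose[OF smooth_X0])
  show "smooth_on S (\<lambda>p. deriv X1 (f p))" by (rule compose[OF smooth_deriv[OF smooth_X1]])
  show "smooth_on S (\<lambda>p. deriv X0 (f p))" by (rule compose[OF smooth_deriv[OF smooth_X0]])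
  show "smooth_on S (\<lambda>p. deriv (deriv X1) (f p))" by (rule compose[OF smooth_deriv[OF smooth_deriv[OF smooth_X1]]])
  show "smooth_on S (\<lambda>p. deriv (deriv X0) (f p))" by (rule compose[OF smooth_deriv[OF smooth_deriv[OF smooth_X0]]])
qed

section \<open>Inversion of the time transformation and action on arbitrary elements\<close>

lemma T_strict_mono: "strict_mono_on I T"
proof (rule strict_mono_onI)
  fix r s assume rs: "r \<in> I" "s \<in> I" "r < s"
  have I: "t \<in> I" if "r \<le> t" "t \<le> s" for t
    using convexI that rs by (meson is_interval_convex_1 mem_is_interval_1_I)
  show "T r < T s"
  proof (rule DERIV_pos_imp_increasing[OF rs(3)])
    fix t assume "r \<le> t" "t \<le> s"
    then show "\<exists>y. (T has_real_derivative y) (at t) \<and> 0 < y"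
      using smooth_on_has_real_derivative[OF smooth_T I] deriv_T[OF I] X1_nz[OF I] by fastforce
  qed
qed

lemma inj_T: "inj_on T I"
  using T_strict_mono strict_mono_on_imp_inj_on by blast

definition "S = inv_into I T"

lemma S_T: "t \<in> I \<Longrightarrow> S (T t) = t"
  unfolding S_def using inj_T by (rule inv_into_f_f)

lemma open_T: "open (T ` I)"
  by (rule invariance_of_domain[OF smooth_on_imp_continuous_on[OF smooth_T] openI inj_T])

lemma smooth_S: "smooth_on (T ` I) S"
  by (rule smooth_on_inverse_function[OF openI smooth_T open_T S_T]) (use deriv_T X1_nz in auto)

text \<open>The transformation projects to the \<open>(t, x)\<close>-plane, so the new arbitrary
  element is the transformation formula composed with the inverse \<open>(S, gx)\<close> of this
  projection.\<close>

lemma maps_class: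
  fixes B :: "real \<times> real \<Rightarrow> real"
  assumes W: "open W" and B: "smooth_on W B"
  obtains W' B' where "open W'" "smooth_on W' B'"
    "\<And>t x. t \<in> I \<Longrightarrow> (t, x) \<in> W \<Longrightarrow> (T t, X1 t * x + X0 t) \<in> W' \<and>
       B' (T t, X1 t * x + X0 t) = B (t, x) / X1 t - m t x / (X1 t)\<^sup>2"
proof -
  \<comment> \<open>The parameter functions are controlled on \<open>I\<close> only, so
    \<open>W\<close> is cut down to the strip over \<open>I\<close>.\<close>
  define W0 where "W0 = W \<inter> (I \<times> UNIV)"
  define \<psi> where "\<psi> = (\<lambda>y. (T (fst y), X1 (fst y) * snd y + X0 (fst y)))"
  define gx where "gx = (\<lambda>y. (snd y - X0 (S (fst y))) / X1 (S (fst y)))"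
  define B' where "B' = (\<lambda>y. B (S (fst y), gx y) / X1 (S (fst y)) - m (S (fst y)) (gx y) / (X1 (S (fst y)))\<^sup>2)"
  have W0: "open W0" "W0 \<subseteq> W" "y \<in> W0 \<Longrightarrow> fst y \<in> I" for y
    using W openI by (auto simp: W0_def open_Times)
  have inv: "S (fst (\<psi> y)) = fst y" "gx (\<psi> y) = snd y" if "y \<in> W0" for y
    using W0(3)[OF that] X1_nz by (simp_all add: \<psi>_def gx_def S_T)
  have "smooth_on W0 \<psi>"
    unfolding \<psi>_def by (intro smooth_intros smooth_on_params W0)
  \<comment> \<open>The explicit left inverse gives injectivity, from which invariance of domain
    derives the openness of the new domain.\<close>
  moreover have "inj_on \<psi> W0"
    by (rule inj_onI) (metis inv prod.collapse)
  ultimately have open_img: "open (\<psi> ` W0)"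
    using invariance_of_domain W0(1) smooth_on_imp_continuous_on by blast
  have "smooth_on (\<psi> ` W0) (\<lambda>y. S (fst y))"
  proof (rule smooth_on_compose[OF smooth_S open_T open_img])
    show "smooth_on (\<psi> ` W0) fst" by (intro smooth_intros open_img)
    show "fst y \<in> T ` I" if "y \<in> \<psi> ` W0" for y
      using that W0(3) unfolding \<psi>_def by fastforce
  qed
  moreover have SI: "S (fst y) \<in> I" if "y \<in> \<psi> ` W0" for y
    using that inv W0(3) by auto
  ultimately have par: "smooth_on (\<psi> ` W0) (\<lambda>y. S (fst y))" 
    "smooth_on (\<psi> ` W0) (\<lambda>p. X1 (S (fst p)))" "smooth_on (\<psi> ` W0) (\<lambda>p. X0 (S (fst p)))"
    "smooth_on (\<psi> ` W0) (\<lambda>p. deriv X1 (S (fst p)))" "smooth_on (\<psi> ` W0) (\<lambda>p. deriv X0 (S (fst p)))"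
    by (simp_all add: smooth_on_params open_img)
  have nz: "X1 (S (fst y)) \<noteq> 0" "(X1 (S (fst y)))\<^sup>2 \<noteq> 0" if "y \<in> \<psi> ` W0" for y
    using X1_nz[OF SI[OF that]] by simp_all
  have gx: "smooth_on (\<psi> ` W0) gx"
    unfolding gx_def by (intro smooth_intros open_img par nz)
  have "smooth_on (\<psi> ` W0) (\<lambda>y. B (S (fst y), gx y))"
    by (rule smooth_on_compose[OF B W open_img smooth_on_Pair[OF open_img par(1) gx]])
       (use inv W0(2) in auto)
  then have "smooth_on (\<psi> ` W0) B'"
    unfolding B'_def m_def by (intro smooth_intros open_img par gx nz)
  moreover have "\<psi> (t, x) \<in> \<psi> ` W0 \<and> B' (\<psi> (t, x)) = B (t, x) / X1 t - m t x / (X1 t)\<^sup>2"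
    if "t \<in> I" "(t, x) \<in> W" for t x
  proof -
    have "(t, x) \<in> W0" using that by (simp add: W0_def)
    then show ?thesis using inv[of "(t, x)"] by (simp add: B'_def)
  qed
  ultimately show thesis
    using that[OF open_img, of B'] unfolding \<psi>_def fst_conv snd_conv by blast
qed

section \<open>Verification of the group conditions on a given domain\<close>

context
  fixes D :: "ext set" and \<Phi> :: "ext \<Rightarrow> ext"
  assumes openD: "open D" and D_I: "\<And>p. p \<in> D \<Longrightarrow> t_of p \<in> I"
    and Phi: "\<And>p. p \<in> D \<Longrightarrow> \<Phi> p = (prolong2 phi (fst p),
      b_of p / X1 (t_of p) - m (t_of p) (x_of p) / (X1 (t_of p))\<^sup>2)"
begin

lemma Phi_eq:
  assumes "p \<in> D"
  shows "\<Phi> p = (((T (t_of p), X1 (t_of p) * x_of p + X0 (t_of p), c1 * u_of p + c2),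
      (P (t_of p) (x_of p) (ut_of p) (ux_of p), Q (t_of p) (ux_of p)),
      (Vtt (t_of p) (x_of p) (ut_of p) (ux_of p) (utt_of p) (utx_of p) (uxx_of p),
       Vtx (t_of p) (x_of p) (ux_of p) (utx_of p) (uxx_of p), Vxx (t_of p) (uxx_of p))),
      b_of p / X1 (t_of p) - m (t_of p) (x_of p) / (X1 (t_of p))\<^sup>2)"
  using Phi[OF assms]
    prolong2_eq[OF D_I[OF assms], of "x_of p" "u_of p" "ut_of p" "ux_of p" "utt_of p" "utx_of p" "uxx_of p"]
  by (simp add: case_prod_unfold)

lemma smooth_Phi: "smooth_on D \<Phi>"
proof -
  have nz: "X1 (t_of p) \<noteq> 0" "X1 (t_of p) ^ n \<noteq> 0" if "p \<in> D" for p n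
    using X1_nz[OF D_I[OF that]] by simp_all
  have "smooth_on D (\<lambda>p. (((T (t_of p), X1 (t_of p) * x_of p + X0 (t_of p), c1 * u_of p + c2),
      (P (t_of p) (x_of p) (ut_of p) (ux_of p), Q (t_of p) (ux_of p)),
      (Vtt (t_of p) (x_of p) (ut_of p) (ux_of p) (utt_of p) (utx_of p) (uxx_of p),
       Vtx (t_of p) (x_of p) (ux_of p) (utx_of p) (uxx_of p), Vxx (t_of p) (uxx_of p))),
      b_of p / X1 (t_of p) - m (t_of p) (x_of p) / (X1 (t_of p))\<^sup>2))"
    unfolding P_def Q_def Vtt_def Vtx_def Vxx_def P_t_def P_x_def P_ut_def P_ux_def m_def m'_def
    by (intro smooth_intros smooth_on_params openD D_I nz)
  then show ?thesis
    using smooth_on_cong[of D \<Phi>, OF openD Phi_eq] by blast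
qed

text \<open>The formulas are triangular in the order t, x, u, \<open>u\<^sub>x\<close>,
  \<open>u\<^sub>t\<close>, \<open>u\<^sub>x\<^sub>x\<close>, \<open>u\<^sub>t\<^sub>x\<close>,
  \<open>u\<^sub>t\<^sub>t\<close>, with B depending on t and x only. Smoothness of the inverse is
  checked along the same chain, and the image is open by invariance of domain.\<close>

lemma diffeo_Phi: "diffeo_on D \<Phi>"
proof -
  define gt where "gt q = S (t_of q)" for q :: ext
  define gx where "gx q = (x_of q - X0 (gt q)) / X1 (gt q)" for q
  define gu where "gu q = (u_of q - c2) / c1" for q :: ext
  define gux where "gux q = X1 (gt q) * ux_of q / c1" for q
  define gut where "gut q = (X1 (gt q))\<^sup>2 * ut_of q / c1 + gux q * m (gt q) (gx q) / X1 (gt q)" for q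
  define guxx where "guxx q = (X1 (gt q))\<^sup>2 * uxx_of q / c1" for q
  \<comment> \<open>Old \<open>u\<^sub>t\<^sub>x\<close> and \<open>u\<^sub>t\<^sub>t\<close> enter
    \<open>Vtx\<close> and \<open>Vtt\<close> through the factor \<open>P_ut\<close>, which is
    nonzero because \<open>c1\<close> is.\<close>
  define gutx where "gutx q = (utx_of q * X1 (gt q) - P_x (gt q) (gux q) - guxx q * P_ux (gt q) (gx q)) / P_ut (gt q)" for q
  define gutt where "gutt q = (utt_of q * (X1 (gt q))\<^sup>2 + m (gt q) (gx q) * utx_of q
    - P_t (gt q) (gx q) (gut q) (gux q) - gutx q * P_ux (gt q) (gx q)) / P_ut (gt q)" for q
  define gb where "gb q = X1 (gt q) * b_of q + m (gt q) (gx q) / X1 (gt q)" for q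
  define g where "g q = (((gt q, gx q, gu q), (gut q, gux q), (gutt q, gutx q, guxx q)), gb q)" for q
  have g: "g (\<Phi> p) = p" if p: "p \<in> D" for p
  proof -
    note nz = X1_nz[OF D_I[OF p]] c1_nz
    note e = Phi_eq[OF p]
    have t: "gt (\<Phi> p) = t_of p" using S_T[OF D_I[OF p]] by (simp add: gt_def e)
    have x: "gx (\<Phi> p) = x_of p" using nz by (simp add: gx_def t) (simp add: e)
    have u: "gu (\<Phi> p) = u_of p" using nz by (simp add: gu_def e)
    have ux: "gux (\<Phi> p) = ux_of p" using nz by (simp add: gux_def t) (simp add: e Q_def)
    have ut: "gut (\<Phi> p) = ut_of p"
      using nz by (simp add: gut_def t x ux) (simp add: e P_def field_simps power2_eq_square power3_eq_cube)
    have uxx: "guxx (\<Phi> p) = uxx_of p" using nz by (simp add: guxx_def t) (simp add: e Vxx_def)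
    have put: "P_ut (t_of p) \<noteq> 0" using nz by (simp add: P_ut_def)
    have utx: "gutx (\<Phi> p) = utx_of p"
      using nz put by (simp add: gutx_def t x ux uxx) (simp add: e Vtx_def)
    have utt: "gutt (\<Phi> p) = utt_of p"
      using nz put by (simp add: gutt_def t x ux ut uxx utx) (simp add: e Vtt_def)
    have b: "gb (\<Phi> p) = b_of p"
      using nz by (simp add: gb_def t x) (simp add: e field_simps power2_eq_square)
    show ?thesis by (simp add: g_def t x u ux ut uxx utx utt b)
  qed
  have "inj_on \<Phi> D" by (rule inj_onI) (metis g)
  then have op: "open (\<Phi> ` D)"
    by (rule invariance_of_domain[OF smooth_on_imp_continuous_on[OF smooth_Phi] openD])
  have gt: "smooth_on (\<Phi> ` D) gt"
    unfolding gt_def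
  proof (rule smooth_on_compose[OF smooth_S open_T op smooth_on_coordinates(1)[OF op]])
    fix q assume "q \<in> \<Phi> ` D"
    then obtain p where "p \<in> D" "q = \<Phi> p" by blast
    then show "t_of q \<in> T ` I" using D_I[of p] by (simp add: Phi_eq)
  qed
  have gt_I: "gt q \<in> I" if "q \<in> \<Phi> ` D" for q
  proof -
    from that obtain p where "p \<in> D" "q = \<Phi> p" by blast
    then show ?thesis using D_I[of p] S_T by (simp add: gt_def Phi_eq)
  qed
  have nz: "X1 (gt q) \<noteq> 0" "X1 (gt q) ^ n \<noteq> 0" "P_ut (gt q) \<noteq> 0" if "q \<in> \<Phi> ` D" for q n
    using X1_nz[OF gt_I[OF that]] c1_nz by (simp_all add: P_ut_def)
  note co = smooth_on_coordinates[OF op]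
  note sm = smooth_intros smooth_on_params op gt gt_I co nz c1_nz
  have x: "smooth_on (\<Phi> ` D) gx" unfolding gx_def by (intro sm)
  have m: "smooth_on (\<Phi> ` D) (\<lambda>q. m (gt q) (gx q))" unfolding m_def by (intro sm x)
  have ux: "smooth_on (\<Phi> ` D) gux" unfolding gux_def by (intro sm)
  have ut: "smooth_on (\<Phi> ` D) gut" unfolding gut_def by (intro sm m ux)
  have uxx: "smooth_on (\<Phi> ` D) guxx" unfolding guxx_def by (intro sm)
  have P_ut: "smooth_on (\<Phi> ` D) (\<lambda>q. P_ut (gt q))" unfolding P_ut_def by (intro sm)
  have P_x: "smooth_on (\<Phi> ` D) (\<lambda>q. P_x (gt q) (gux q))" unfolding P_x_def by (intro sm ux)
  have P_ux: "smooth_on (\<Phi> ` D) (\<lambda>q. P_ux (gt q) (gx q))" unfolding P_ux_def by (intro sm m)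
  have P_t: "smooth_on (\<Phi> ` D) (\<lambda>q. P_t (gt q) (gx q) (gut q) (gux q))"
    unfolding P_t_def m'_def by (intro sm m ux ut x)
  have utx: "smooth_on (\<Phi> ` D) gutx" unfolding gutx_def by (intro sm ux uxx P_ut P_x P_ux)
  have "smooth_on (\<Phi> ` D) g"
    unfolding g_def gutt_def gb_def gu_def by (intro sm ux ut uxx utx P_ut P_ux P_t m x)
  then show ?thesis
    unfolding diffeo_on_def using smooth_Phi op g by blast
qed

lemma contact_Phi: "contact_on D \<Phi>"
  unfolding contact_on_def
proof (intro ballI allI impI)
  fix p and v :: ext assume p: "p \<in> D" and v: "fst v \<in> cartan (fst p)"
  note d = smooth_on_has_derivative[OF smooth_Phi p]
  have dc: "((\<lambda>q. t_of (\<Phi> q)) has_derivative (\<lambda>v. t_of (dd \<Phi> p v))) (at p)"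
    "((\<lambda>q. x_of (\<Phi> q)) has_derivative (\<lambda>v. x_of (dd \<Phi> p v))) (at p)"
    "((\<lambda>q. u_of (\<Phi> q)) has_derivative (\<lambda>v. u_of (dd \<Phi> p v))) (at p)"
    "((\<lambda>q. ut_of (\<Phi> q)) has_derivative (\<lambda>v. ut_of (dd \<Phi> p v))) (at p)"
    "((\<lambda>q. ux_of (\<Phi> q)) has_derivative (\<lambda>v. ux_of (dd \<Phi> p v))) (at p)"
    by (intro has_derivative_fst has_derivative_snd d)+
  note hd = has_derivative_coordinates
  note nz = X1_nz[OF D_I[OF p]]
  have t: "t_of (dd \<Phi> p v) = (X1 (t_of p))\<^sup>2 * t_of v"
    by (rule has_derivative_eq_on_open[OF openD p _ dc(1) has_derivative_params(1)[OF hd(1) D_I[OF p]]])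
       (simp add: Phi_eq)
  have x: "x_of (dd \<Phi> p v) = X1 (t_of p) * x_of v + m (t_of p) (x_of p) * t_of v"
    by (rule has_derivative_eq_on_open[OF openD p _ dc(2) has_derivative_X[OF hd(1,2,1,1) D_I[OF p]]])
       (simp add: Phi_eq)
  have u: "u_of (dd \<Phi> p v) = c1 * u_of v"
    by (rule has_derivative_eq_on_open[OF openD p _ dc(3) has_derivative_add_const[OF has_derivative_mult_right[OF hd(3)]]])
       (simp add: Phi_eq)
  have ux: "ux_of (dd \<Phi> p v) = c1 / X1 (t_of p) * ux_of v
        - c1 * ux_of p * deriv X1 (t_of p) / (X1 (t_of p))\<^sup>2 * t_of v"
    by (rule has_derivative_eq_on_open[OF openD p _ dc(5) has_derivative_Q[OF hd(1,1,1,5) D_I[OF p]]])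
       (simp add: Phi_eq)
  have ut: "ut_of (dd \<Phi> p v) = P_t (t_of p) (x_of p) (ut_of p) (ux_of p) * t_of v +
        P_x (t_of p) (ux_of p) * x_of v + P_ut (t_of p) * ut_of v + P_ux (t_of p) (x_of p) * ux_of v"
    by (rule has_derivative_eq_on_open[OF openD p _ dc(4) has_derivative_P[OF hd(1,2,4,5) D_I[OF p]]])
       (simp add: Phi_eq)
  have v': "u_of v = ut_of p * t_of v + ux_of p * x_of v"
    "ut_of v = utt_of p * t_of v + utx_of p * x_of v" "ux_of v = utx_of p * t_of v + uxx_of p * x_of v"
    using v by (simp_all add: cartan_iff)
  show "fst (dd \<Phi> p v) \<in> cartan (fst (\<Phi> p))"
    unfolding cartan_iff t x u ux ut v' Phi_eq[OF p] fst_conv snd_conv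
  proof (intro conjI)
    show "c1 * (ut_of p * t_of v + ux_of p * x_of v) =
      P (t_of p) (x_of p) (ut_of p) (ux_of p) * ((X1 (t_of p))\<^sup>2 * t_of v) +
      Q (t_of p) (ux_of p) * (X1 (t_of p) * x_of v + m (t_of p) (x_of p) * t_of v)"
      using nz by (simp add: P_def Q_def field_simps power2_eq_square power3_eq_cube)
    show "P_t (t_of p) (x_of p) (ut_of p) (ux_of p) * t_of v + P_x (t_of p) (ux_of p) * x_of v +
        P_ut (t_of p) * (utt_of p * t_of v + utx_of p * x_of v) +
        P_ux (t_of p) (x_of p) * (utx_of p * t_of v + uxx_of p * x_of v) =
      Vtt (t_of p) (x_of p) (ut_of p) (ux_of p) (utt_of p) (utx_of p) (uxx_of p) * ((X1 (t_of p))\<^sup>2 * t_of v) +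
      Vtx (t_of p) (x_of p) (ux_of p) (utx_of p) (uxx_of p) *
        (X1 (t_of p) * x_of v + m (t_of p) (x_of p) * t_of v)"
      using nz by (simp add: Vtt_def Vtx_def field_simps)
    \<comment> \<open>Here symmetry of mixed derivatives is at stake: \<open>Vtx\<close> was formed
      from the x-derivative of \<open>P\<close> and must also match the t-derivative of
      \<open>Q\<close>.\<close>
    show "c1 / X1 (t_of p) * (utx_of p * t_of v + uxx_of p * x_of v) -
        c1 * ux_of p * deriv X1 (t_of p) / (X1 (t_of p))\<^sup>2 * t_of v =
      Vtx (t_of p) (x_of p) (ux_of p) (utx_of p) (uxx_of p) * ((X1 (t_of p))\<^sup>2 * t_of v) +
      Vxx (t_of p) (uxx_of p) * (X1 (t_of p) * x_of v + m (t_of p) (x_of p) * t_of v)"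
      using nz by (simp add: Vtx_def Vxx_def P_x_def P_ut_def P_ux_def field_simps power2_eq_square power3_eq_cube)
  qed
qed

lemma projectable_Phi: "projectable_on D \<Phi>"
  unfolding projectable_on_def
proof (intro conjI exI)
  show "\<forall>(j, b)\<in>D. fst (fst (\<Phi> (j, b))) = phi (fst j)"
    by (auto simp: Phi_eq case_prod_unfold)
  show "\<forall>(j, b)\<in>D. fst (\<Phi> (j, b)) = prolong2 phi j"
    by (auto simp: Phi)
qed

lemma preserves_class_Phi: "preserves_class_on \<epsilon> D \<Phi>"
  unfolding preserves_class_on_def
proof (intro allI impI)
  fix W and B :: "real \<times> real \<Rightarrow> real" assume W: "open W" "smooth_on W B"
  obtain W' B' where W': "open W'" "smooth_on W' B'" and
    *: "\<And>t x. t \<in> I \<Longrightarrow> (t, x) \<in> W \<Longrightarrow> (T t, X1 t * x + X0 t) \<in> W' \<and>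
       B' (T t, X1 t * x + X0 t) = B (t, x) / X1 t - m t x / (X1 t)\<^sup>2"
    using maps_class[OF W] by metis
  show "\<exists>W' B'. open W' \<and> smooth_on W' B' \<and>
         (\<forall>j. tx_of j \<in> W \<longrightarrow> (j, B (tx_of j)) \<in> D \<longrightarrow>
           (case \<Phi> (j, B (tx_of j)) of (j', b') \<Rightarrow>
             tx_of j' \<in> W' \<and> b' = B' (tx_of j') \<and>
             (j \<in> kolmogorov \<epsilon> B \<longleftrightarrow> j' \<in> kolmogorov \<epsilon> B')))"
  proof (intro exI[of _ W'] exI[of _ B'] conjI allI impI W')
    fix j assume j: "tx_of j \<in> W" "(j, B (tx_of j)) \<in> D"
    define p where "p = (j, B (tx_of j))"
    have p: "p \<in> D" "fst p = j" "b_of p = B (t_of p, x_of p)" "(t_of p, x_of p) \<in> W"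
      using j by (simp_all add: p_def tx_of_eq)
    note nz = X1_nz[OF D_I[OF p(1)]] c1_nz
    have B': "(T (t_of p), X1 (t_of p) * x_of p + X0 (t_of p)) \<in> W'"
      "B' (T (t_of p), X1 (t_of p) * x_of p + X0 (t_of p)) =
        b_of p / X1 (t_of p) - m (t_of p) (x_of p) / (X1 (t_of p))\<^sup>2"
      using *[OF D_I[OF p(1)] p(4)] p(3) by simp_all
    have "P (t_of p) (x_of p) (ut_of p) (ux_of p) - (\<epsilon> * Vxx (t_of p) (uxx_of p) +
        (b_of p / X1 (t_of p) - m (t_of p) (x_of p) / (X1 (t_of p))\<^sup>2) * Q (t_of p) (ux_of p)) =
      c1 / (X1 (t_of p))\<^sup>2 * (ut_of p - (\<epsilon> * uxx_of p + b_of p * ux_of p))"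
      using nz by (simp add: P_def Q_def Vxx_def field_simps power2_eq_square power3_eq_cube)
    then have iff: "ut_of p = \<epsilon> * uxx_of p + b_of p * ux_of p \<longleftrightarrow>
      P (t_of p) (x_of p) (ut_of p) (ux_of p) = \<epsilon> * Vxx (t_of p) (uxx_of p) +
        (b_of p / X1 (t_of p) - m (t_of p) (x_of p) / (X1 (t_of p))\<^sup>2) * Q (t_of p) (ux_of p)"
      using nz by (metis eq_iff_diff_eq_0 divide_eq_0_iff mult_eq_0_iff power2_eq_square)
    have "j \<in> kolmogorov \<epsilon> B \<longleftrightarrow> ut_of p = \<epsilon> * uxx_of p + b_of p * ux_of p"
      using p by (simp add: kolmogorov_iff tx_of_eq)
    then show "case \<Phi> (j, B (tx_of j)) of (j', b') \<Rightarrow>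
             tx_of j' \<in> W' \<and> b' = B' (tx_of j') \<and>
             (j \<in> kolmogorov \<epsilon> B \<longleftrightarrow> j' \<in> kolmogorov \<epsilon> B')"
      unfolding p_def[symmetric] Phi_eq[OF p(1)] using B' iff
      by (simp add: kolmogorov_iff tx_of_eq)
  qed
qed

lemma in_equivalence_group: "\<Phi> \<in> equivalence_group \<epsilon> D"
  by (simp add: equivalence_group_def diffeo_Phi projectable_Phi contact_Phi preserves_class_Phi)

end

end

theorem corollary26:
  fixes \<epsilon> :: real and D :: "ext set"
  assumes "\<epsilon> \<in> {-1, 1}"
    and "local_domain \<epsilon> D"
  shows "equivalence_group \<epsilon> D =
    {\<Phi>. \<exists>(T :: real \<Rightarrow> real) (X1 :: real \<Rightarrow> real) (X0 :: real \<Rightarrow> real) (c1 :: real) (c2 :: real).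
       smooth_on (time_range D) T \<and> smooth_on (time_range D) X1 \<and> smooth_on (time_range D) X0 \<and>
       (\<forall>t\<in>time_range D. X1 t \<noteq> 0 \<and> deriv T t = (X1 t)\<^sup>2) \<and> c1 \<noteq> 0 \<and>
       (\<forall>t x u ju b. (((t, x, u), ju), b) \<in> D \<longrightarrow>
          \<Phi> (((t, x, u), ju), b) =
            (prolong2 (\<lambda>(t, x, u). (T t, X1 t * x + X0 t, c1 * u + c2)) ((t, x, u), ju),
             b / X1 t - (deriv X1 t * x + deriv X0 t) / (X1 t)\<^sup>2))}"
    (is "_ = ?R")
proof (intro equalityI subsetI)
  fix \<Phi> assume \<Phi>: "\<Phi> \<in> equivalence_group \<epsilon> D"
  show "\<Phi> \<in> ?R"
  proof (cases "D = {}")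
    \<comment> \<open>Without a point of \<open>D\<close> there is nothing to read constants from;
      the time range is empty, so any parameters with nonzero \<open>c1\<close> will do.\<close>
    case True
    then show ?thesis
      by (auto simp: time_range_def intro!: smooth_on_const exI[of _ "1 :: real"])
  next
    case False
    interpret kolmogorov_equivalence \<epsilon> D \<Phi>
      using assms \<Phi> by unfold_locales auto
    obtain T X1 X0 c1 c2 where tr: "kolmogorov_transformation (time_range D) T X1 X0 c1"
      and \<Phi>_eq: "\<And>p. p \<in> D \<Longrightarrow> \<Phi> p =
        (prolong2 (\<lambda>(t, x, u). (T t, X1 t * x + X0 t, c1 * u + c2)) (fst p),
         b_of p / X1 (t_of p) - (deriv X1 (t_of p) * x_of p + deriv X0 (t_of p)) / (X1 (t_of p))\<^sup>2)"
      using explicit_form[OF False] by blast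
    interpret kolmogorov_transformation "time_range D" T X1 X0 c1 c2 by (rule tr)
    show ?thesis
      using smooth_T smooth_X1 smooth_X0 X1_nz deriv_T c1_nz \<Phi>_eq
      by (intro CollectI exI[of _ T] exI[of _ X1] exI[of _ X0] exI[of _ c1] exI[of _ c2]) simp
  qed
next
  fix \<Phi> assume "\<Phi> \<in> ?R"
  then obtain T X1 X0 c1 c2 where
    tr: "smooth_on (time_range D) T" "smooth_on (time_range D) X1" "smooth_on (time_range D) X0"
      "\<And>t. t \<in> time_range D \<Longrightarrow> X1 t \<noteq> 0" "\<And>t. t \<in> time_range D \<Longrightarrow> deriv T t = (X1 t)\<^sup>2" "c1 \<noteq> 0"
    and \<Phi>_eq: "\<And>t x u ju b. (((t, x, u), ju), b) \<in> D \<Longrightarrow>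
          \<Phi> (((t, x, u), ju), b) =
            (prolong2 (\<lambda>(t, x, u). (T t, X1 t * x + X0 t, c1 * u + c2)) ((t, x, u), ju),
             b / X1 t - (deriv X1 t * x + deriv X0 t) / (X1 t)\<^sup>2)"
    by auto
  have D: "open D" "convex D" using assms(2) by (auto simp: local_domain_def)
  interpret kolmogorov_transformation "time_range D" T X1 X0 c1 c2
    using tr D by unfold_locales (auto simp: open_time_range convex_time_range)
  show "\<Phi> \<in> equivalence_group \<epsilon> D"
  proof (rule in_equivalence_group[OF D(1)])
    show "t_of p \<in> time_range D" if "p \<in> D" for p
      using that by (simp add: time_range_eq)
    show "\<Phi> p = (prolong2 (\<lambda>(t, x, u). (T t, X1 t * x + X0 t, c1 * u + c2)) (fst p),
        b_of p / X1 (t_of p) - m (t_of p) (x_of p) / (X1 (t_of p))\<^sup>2)" if "p \<in> D" for p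
      using \<Phi>_eq[of "t_of p" "x_of p" "u_of p" "snd (fst p)" "b_of p"] that by (simp add: m_def)
  qed
qed

end
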